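(* Let $\sigma>0$, $0<\mu<h$, and consider the Lindley process with Laplace increments with location $\mu$ and scale $\sigma$. For $n\ge1$ let $\ell_n=\min\{n+1,\min_{r>0}\{r\mu\ge h\}\}$ ($r$ integer), $m_n^i=\min(n,\ell_n-i+1)$, and partition $[0,h)$ into $$I_n^1=[0,h-(\ell_n-1)\mu),\qquad I_n^i=[h-(\ell_n-i+1)\mu,\,h-(\ell_n-i)\mu),\quad i=2,\dots,\ell_n.$$ Then for $n>0$ and $0\le x<h$ the probability distribution of the first exit time through $h$ is $P(n|x)=\sum_{i=1}^{\ell_n}P_i(n|x)$, where for $1\le i\le\ell_n$ $$P_i(n|x)=\Big\{\sum_{j=0}^{m_n^i-1}\frac1{2^n\sigma^{n-1}}\big[\alpha_n^{(i,j)}(x+n\mu)^je^{x/\sigma}+\beta_n^{(i,j)}(x+n\mu)^je^{-x/\sigma}\big]+\eta_n^{(i,0)}\Big\}\mathbf 1_{I_n^i}(x).$$ The coefficients are defined by the following recursive relations, for $1\le i\le\ell_{n+1}$ and $1\le j\le m_{n+1}^i-1$, where $i^*$ is the index of the interval of the partition $\{I_n^1,\dots,I_n^{\ell_n}\}$ that contains $x+\mu$, for $x\in I_{n+1}^i$ (with $i^*=\ell_n+1$ when $x+\mu\ge h$, which is the case $i=\ell_{n+1}$, and $\eta_n^{(\ell_n+1,0)}=0$): $$\alpha_{n+1}^{(i,0)}=e^{\mu/\sigma}\Big\{\sum_{j=i^*+1}^{\ell_n}K_n^j+\sum_{k=0}^{m_n^{i^*}-1}\Big[\alpha_n^{(i^*,k)}\Big(\frac{(h-(\ell_n-i^*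 )\mu+n\mu)^{k+1}}{k+1}+k!\frac{\sigma^{k+1}(-1)^k}{2^{k+1}}\Big)-\beta_n^{(i^*,k)}\frac{e^{2n\mu/\sigma}\sigma^{k+1}}{2^{k+1}}\Gamma\Big(1+k,\frac{2(h-(\ell_n-i^* )\mu+n\mu)}\sigma\Big)\Big]-\eta_n^{(i^*,0)}(2\sigma)^ne^{-\frac{h-(\ell_n-i^* )\mu}\sigma}\Big\},$$ $$\alpha_{n+1}^{(i,j)}=-e^{\mu/\sigma}\sum_{k=j-1}^{m_n^{i^*}-1}\alpha_n^{(i^*,k)}\Big(-\frac\sigma2\Big)^{k-j+1}\frac{k!}{j!},$$ $$\beta_{n+1}^{(i,0)}=e^{-\mu/\sigma}\Big\{\sum_{j=0}^{i^*-1}K_n^j+\sum_{k=0}^{m_n^{i^*}-1}\Big[-\alpha_n^{(i^*,k)}\frac{e^{-2n\mu/\sigma}\sigma^{k+1}(-1)^k}{2^{k+1}}\Gamma\Big(1+k,\frac{-2(h-(\ell_n-i^*+1)\mu+n\mu)}\sigma\Big)+\beta_n^{(i^*,k)}\Big(-\frac{(h-(\ell_n-i^*+1)\mu+n\mu)^{k+1}}{k+1}+k!\frac{\sigma^{k+1}}{2^{k+1}}\Big)\Big]-\eta_n^{(i^*,0)}(2\sigma)^ne^{\frac{h-(\ell_n-i^*+1)\mu}\sigma}\Big\},$$ $$\beta_{n+1}^{(i,j)}=e^{-\mu/\sigma}\sum_{k=j-1}^{m_n^{i^*}-1}\beta_n^{(i^*,k)}\Big(\frac\sigma2\Big)^{k-j+1}\frac{k!}{j!},\qquad\eta_{n+1}^{(i,0)}=\eta_n^{(i^*,0)},$$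 where $$K_n^0=\sum_{k=0}^{m_n^1-1}\sigma\big[\alpha_n^{(1,k)}(n\mu)^k+\beta_n^{(1,k)}(n\mu)^k\big]+(2\sigma)^n\eta_n^{(1,0)},$$ for $j=1,\dots,i^*-1$ $$K_n^j=\sum_{k=0}^{m_n^j-1}\Big\{\alpha_n^{(j,k)}\frac{e^{-2n\mu/\sigma}\sigma^{k+1}(-1)^k}{2^{k+1}}\Gamma\Big(1+k,\frac{-2(y+n\mu)}\sigma\Big)\Big|_{I_n^j}+\beta_n^{(j,k)}\frac{(y+n\mu)^{k+1}}{k+1}\Big|_{I_n^j}\Big\}+\eta_n^{(j,0)}(2\sigma)^ne^{y/\sigma}\Big|_{I_n^j},$$ and for $j=i^*+1,\dots,\ell_n$ $$K_n^j=\sum_{k=0}^{m_n^j-1}\Big\{\alpha_n^{(j,k)}\frac{(y+n\mu)^{k+1}}{k+1}\Big|_{I_n^j}-\beta_n^{(j,k)}\frac{e^{2n\mu/\sigma}\sigma^{k+1}}{2^{k+1}}\Gamma\Big(1+k,\frac{2(y+n\mu)}\sigma\Big)\Big|_{I_n^j}\Big\}-\eta_n^{(j,0)}(2\sigma)^ne^{-y/\sigma}\Big|_{I_n^j}.$$ The initial values are $$\eta_1^{(1,0)}=\beta_1^{(1,0)}=\alpha_1^{(2,0)}=0,\quad\alpha_1^{(1,0)}=e^{(\mu-h)/\sigma},\quad\eta_1^{(2,0)}=1,\quad\beta_1^{(2,0)}=-e^{-(\mu-h)/\sigma}.$$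
   Context: Lindley process with Laplace increments: $Z_1,Z_2,\dots$ are i.i.d. real random variables with density $f_Z(z)=\frac{1}{2\sigma}e^{-|z-\mu|/\sigma}$, and $W_0=x\ge0$, $W_n=\max(0,W_{n-1}+Z_n)$ for $n\ge1$. For fixed $h>0$ and $x\in[0,h)$, the first exit time (FET) from $[0,h]$ through $h$ is $N_x=\min\{n>0: W_n\ge h\}$ given $W_0=x$, and $P(n|x)=\mathbb P[N_x=n]$ for integers $n>0$. $\Gamma(m,y)=\int_y^\infty t^{m-1}e^{-t}\,dt$ is the incomplete Gamma function ($m\ge1$ integer, $y$ real). For an interval $I$ with endpoints $p\le q$, $\phi(y)|_I=\phi(q)-\phi(p)$. Empty sums (upper index smaller than lower index) are $0$; in particular $m_n^{\ell_n+1}=0$, so sums with upper index $m_n^{\ell_n+1}-1$ vanish.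
   Formalization: In the recursion for β_{n+1}^{(i,0)}, the expression h−(ℓ_n−i*+1)μ is replaced by the left endpoint of I_n^{i*}, which is 0 when i*=1 (unchanged for i*≥2); as printed the formula is false, e.g. for n+1=2, i=1, h>2μ. *)

theory Defs
  imports "HOL-Probability.Probability"
begin

definition laplace_density :: "real \<Rightarrow> real \<Rightarrow> real \<Rightarrow> real" where
  "laplace_density \<mu> \<sigma> z = 1 / (2 * \<sigma>) * exp (- \<bar>z - \<mu>\<bar> / \<sigma>)"

text \<open>The increments are \<open>Z 1, Z 2, \<dots>\<close>; \<open>Z 0\<close> is never used.\<close>

primrec lindley :: "real \<Rightarrow> (nat \<Rightarrow> 'a \<Rightarrow> real) \<Rightarrow> nat \<Rightarrow> 'a \<Rightarrow> real" where
  "lindley x Z 0 \<omega> = x"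
| "lindley x Z (Suc n) \<omega> = max 0 (lindley x Z n \<omega> + Z (Suc n) \<omega>)"

text \<open>The value is \<open>\<infinity>\<close> if the process never reaches \<open>h\<close>.\<close>

definition exit_time :: "real \<Rightarrow> real \<Rightarrow> (nat \<Rightarrow> 'a \<Rightarrow> real) \<Rightarrow> 'a \<Rightarrow> enat" where
  "exit_time h x Z \<omega> = Inf {enat n | n. 0 < n \<and> h \<le> lindley x Z n \<omega>}"

definition inc_Gamma :: "nat \<Rightarrow> real \<Rightarrow> real" where
  "inc_Gamma m y = (LINT t:{y..}|lborel. t ^ (m - 1) * exp (- t))"

context
  fixes \<mu> \<sigma> h :: real
begin

definition ell :: "nat \<Rightarrow> nat" where
  "ell n = min (n + 1) (LEAST r. 0 < r \<and> h \<le> real r * \<mu>)"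

text \<open>Used for \<open>i \<le> ell n + 1\<close> only, so the subtraction is not truncated;
  \<open>mm n (ell n + 1) = 0\<close>.\<close>

definition mm :: "nat \<Rightarrow> nat \<Rightarrow> nat" where
  "mm n i = min n (ell n + 1 - i)"

definition lo :: "nat \<Rightarrow> nat \<Rightarrow> real" where
  "lo n i = (if i = 1 then 0 else h - (real (ell n) - real i + 1) * \<mu>)"

definition up :: "nat \<Rightarrow> nat \<Rightarrow> real" where
  "up n i = h - (real (ell n) - real i) * \<mu>"

definition Ivl :: "nat \<Rightarrow> nat \<Rightarrow> real set" where
  "Ivl n i = {lo n i ..< up n i}"

text \<open>The bracket \<open>\<phi>(y)|\<^sub>I\<close> for \<open>I = Ivl n i\<close>.\<close>

definition incr :: "nat \<Rightarrow> nat \<Rightarrow> (real \<Rightarrow> real) \<Rightarrow> real" where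
  "incr n i \<phi> = \<phi> (up n i) - \<phi> (lo n i)"

definition shift_index :: "nat \<Rightarrow> nat \<Rightarrow> nat \<Rightarrow> bool" where
  "shift_index n i k \<longleftrightarrow>
     (\<forall>x \<in> Ivl (Suc n) i. if h \<le> x + \<mu> then k = ell n + 1
                        else k \<in> {1..ell n} \<and> x + \<mu> \<in> Ivl n k)"

text \<open>The index \<open>i\<^sup>*\<close>; it depends on \<open>n\<close> and \<open>i\<close> but not on the point of \<open>Ivl (n + 1) i\<close>,
  see \<open>shift_index_ex1\<close> below.\<close>

definition istar :: "nat \<Rightarrow> nat \<Rightarrow> nat" where
  "istar n i = (THE k. shift_index n i k)"

lemma ell_least: 
  assumes "0 < \<mu>" "\<mu> < h"
  defines "R \<equiv> (LEAST r::nat. 0 < r \<and> h \<le> real r * \<mu>)"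
  shows "h \<le> real R * \<mu>" and "r < R \<Longrightarrow> real r * \<mu> < h" and "2 \<le> R"
proof -
  let ?P = "\<lambda>r::nat. 0 < r \<and> h \<le> real r * \<mu>"
  obtain r0 :: nat where r0: "h / \<mu> < real r0"
    using reals_Archimedean2 by blast
  have "0 < h / \<mu>" using assms by simp
  with r0 have "0 < r0" by (metis of_nat_0_less_iff order_less_trans)
  with r0 assms(1) have "?P r0" by (simp add: field_simps)
  then have PR: "?P R" unfolding R_def by (rule LeastI)
  then show "h \<le> real R * \<mu>" by simp
  show lt: "real r * \<mu> < h" if "r < R" for r
  proof (cases "r = 0")
    case False
    with not_less_Least[OF that[unfolded R_def]] show ?thesis by auto
  qed (use assms in simp)
  have "R \<noteq> 1" using PR assms by auto
  with PR show "2 \<le> R" by auto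
qed

lemma Ivl_disjoint:
  assumes "0 < \<mu>" "1 \<le> k" "1 \<le> l" "y \<in> Ivl n k" "y \<in> Ivl n l"
  shows "k = l"
proof -
  have False if "k < l" "1 \<le> k" "y \<in> Ivl n k" "y \<in> Ivl n l" for k l
  proof -
    have "real k + 1 \<le> real l" using that by linarith
    then have "(real (ell n) - real l + 1) * \<mu> \<le> (real (ell n) - real k) * \<mu>"
      using assms(1) by (intro mult_right_mono) auto
    then have "up n k \<le> lo n l" using that by (auto simp: up_def lo_def)
    with that show False by (auto simp: Ivl_def)
  qed
  with assms show ?thesis by (metis linorder_neqE_nat)
qed

lemma shift_index_ex1:
  assumes "0 < \<mu>" "\<mu> < h" "1 \<le> n" "i \<in> {1..ell (Suc n)}"
  shows "\<exists>!k. shift_index n i k"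
proof -
  define R where "R = (LEAST r::nat. 0 < r \<and> h \<le> real r * \<mu>)"
  note R = ell_least[OF assms(1,2), folded R_def]
  have ell: "ell n = min (n + 1) R" for n by (simp add: ell_def R_def)
  define k where "k = (if ell (Suc n) = ell n then i + 1 else i)"
  have ne: "lo (Suc n) i < up (Suc n) i"
  proof (cases "i = 1")
    case True
    have "ell (Suc n) - 1 < R" using R(3) by (auto simp: ell)
    from R(2)[OF this] True assms(4) show ?thesis by (simp add: lo_def up_def of_nat_diff)
  next
    case False
    then show ?thesis using assms(1) by (simp add: lo_def up_def algebra_simps)
  qed
  then have mem: "lo (Suc n) i \<in> Ivl (Suc n) i" by (simp add: Ivl_def)
  have ex: "shift_index n i k"
    unfolding shift_index_def
  proof
    fix x assume x: "x \<in> Ivl (Suc n) i"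
    show "if h \<le> x + \<mu> then k = ell n + 1 else k \<in> {1..ell n} \<and> x + \<mu> \<in> Ivl n k"
    proof (cases "ell (Suc n) = ell n")
      case True
      then have e: "ell n = R" "ell (Suc n) = R" by (auto simp: ell split: if_splits)
      have k: "k = i + 1" using True by (simp add: k_def)
      have xu: "x + \<mu> < up n k" using x e k by (simp add: Ivl_def up_def algebra_simps)
      have xl: "lo n k \<le> x + \<mu>"
        using x e k R(1) assms(4)
        by (auto simp: Ivl_def lo_def algebra_simps split: if_splits)
      show ?thesis
      proof (cases "i = R")
        case True
        then have "h \<le> x + \<mu>" using xl k e assms(4) by (auto simp: lo_def)
        then show ?thesis using True e k by simp
      next
        case False
        then have iR: "i + 1 \<le> R" using assms(4) e by auto
        then have "real i + 1 \<le> real R" by linarith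
        then have "up n k \<le> h" using assms(1) k e by (simp add: up_def)
        with xu have "\<not> h \<le> x + \<mu>" by simp
        then show ?thesis using iR k e xu xl by (simp add: Ivl_def)
      qed
    next
      case False
      then have e: "ell n = n + 1" "ell (Suc n) = n + 2" "n + 1 < R" by (auto simp: ell)
      have k: "k = i" using False by (simp add: k_def)
      have xu: "x + \<mu> < up n k" using x e k by (simp add: Ivl_def up_def algebra_simps)
      have xl: "lo n k \<le> x + \<mu>"
        using x e k assms(1,4) by (auto simp: Ivl_def lo_def algebra_simps split: if_splits)
      show ?thesis
      proof (cases "i = n + 2")
        case True
        then have "h \<le> x + \<mu>" using xl k e by (auto simp: lo_def)
        then show ?thesis using True e k by simp
      next
        case False
        then have iR: "i \<le> n + 1" using assms(4) e by auto
        then have "real i \<le> real n + 1" by linarith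
        then have "up n k \<le> h" using assms(1) k e by (simp add: up_def)
        with xu have "\<not> h \<le> x + \<mu>" by simp
        then show ?thesis using iR k e xu xl assms(4) by (simp add: Ivl_def)
      qed
    qed
  qed
  have "l = k" if "shift_index n i l" for l
    using that ex mem Ivl_disjoint[OF assms(1), of k l _ n]
    unfolding shift_index_def by (fastforce split: if_splits)
  with ex show ?thesis by blast
qed

text \<open>
  \<open>alpha n i j\<close>, \<open>beta n i j\<close>, \<open>eta n i\<close> are the coefficients with indices \<open>n\<close>, \<open>(i, j)\<close> and
  \<open>(i, 0)\<close>, meaningful for \<open>1 \<le> n\<close>, \<open>1 \<le> i \<le> ell n\<close>, \<open>j < mm n i\<close>, except that \<open>eta n (ell n + 1) = 0\<close>
  is part of the convention. Index \<open>n = 0\<close> is a dummy: the clause for \<open>Suc n\<close> gives the initial value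
  if \<open>n = 0\<close>, and otherwise the step from \<open>n\<close> to \<open>n + 1\<close>. \<open>K0\<close>, \<open>K_below\<close>, \<open>K_above\<close> are the
  constants \<open>K\<^sub>n\<^sup>j\<close> for \<open>j = 0\<close>, \<open>1 \<le> j < i\<^sup>*\<close> and \<open>i\<^sup>* < j \<le> ell n\<close>. Sums over \<open>{..<m}\<close> and \<open>{j-1..<m}\<close>
  avoid the truncated upper limit \<open>m - 1\<close>.

  In the clause for \<open>beta\<close> the left endpoint of the \<open>i\<^sup>*\<close>-th interval is \<open>lo n (istar n i)\<close>. This is
  \<open>h - (ell n - i\<^sup>* + 1) \<mu>\<close> for \<open>i\<^sup>* \<ge> 2\<close>, but \<open>0\<close> for \<open>i\<^sup>* = 1\<close>, where the former expression is
  in general not the endpoint of the interval (and would make the resulting formula false).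
\<close>

function (sequential) alpha :: "nat \<Rightarrow> nat \<Rightarrow> nat \<Rightarrow> real"
  and beta :: "nat \<Rightarrow> nat \<Rightarrow> nat \<Rightarrow> real"
  and eta :: "nat \<Rightarrow> nat \<Rightarrow> real"
  and K0 :: "nat \<Rightarrow> real"
  and K_below :: "nat \<Rightarrow> nat \<Rightarrow> real"
  and K_above :: "nat \<Rightarrow> nat \<Rightarrow> real"
where
  "alpha 0 i j = 0"
| "alpha (Suc n) i j =
    (if n = 0 then (if i = 1 \<and> j = 0 then exp ((\<mu> - h) / \<sigma>) else 0)
     else if j = 0 then
       exp (\<mu> / \<sigma>) *
        ((\<Sum>l = istar n i + 1..ell n. K_above n l)
         + (\<Sum>k<mm n (istar n i).
              alpha n (istar n i) k *
                ((up n (istar n i) + real n * \<mu>) ^ (k + 1) / real (k + 1)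
                 + fact k * (\<sigma> ^ (k + 1) * (-1) ^ k / 2 ^ (k + 1)))
              - beta n (istar n i) k * (exp (2 * real n * \<mu> / \<sigma>) * \<sigma> ^ (k + 1) / 2 ^ (k + 1))
                * inc_Gamma (1 + k) (2 * (up n (istar n i) + real n * \<mu>) / \<sigma>))
         - eta n (istar n i) * (2 * \<sigma>) ^ n * exp (- up n (istar n i) / \<sigma>))
     else
       - exp (\<mu> / \<sigma>) *
        (\<Sum>k = j - 1..<mm n (istar n i).
           alpha n (istar n i) k * (- \<sigma> / 2) ^ (k + 1 - j) * (fact k / fact j)))"
| "beta 0 i j = 0"
| "beta (Suc n) i j =
    (if n = 0 then (if i = 2 \<and> j = 0 then - exp (- (\<mu> - h) / \<sigma>) else 0)
     else if j = 0 then
       exp (- \<mu> / \<sigma>) *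
        (K0 n + (\<Sum>l = 1..<istar n i. K_below n l)
         + (\<Sum>k<mm n (istar n i).
              - alpha n (istar n i) k
                * (exp (- 2 * real n * \<mu> / \<sigma>) * \<sigma> ^ (k + 1) * (-1) ^ k / 2 ^ (k + 1))
                * inc_Gamma (1 + k) (- 2 * (lo n (istar n i) + real n * \<mu>) / \<sigma>)
              + beta n (istar n i) k *
                (- ((lo n (istar n i) + real n * \<mu>) ^ (k + 1) / real (k + 1))
                 + fact k * (\<sigma> ^ (k + 1) / 2 ^ (k + 1))))
         - eta n (istar n i) * (2 * \<sigma>) ^ n * exp (lo n (istar n i) / \<sigma>))
     else
       exp (- \<mu> / \<sigma>) *
        (\<Sum>k = j - 1..<mm n (istar n i).
           beta n (istar n i) k * (\<sigma> / 2) ^ (k + 1 - j) * (fact k / fact j)))"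
| "eta 0 i = 0"
| "eta (Suc n) i =
    (if n = 0 then (if i = 2 then 1 else 0)
     else if i \<le> ell (Suc n) then eta n (istar n i) else 0)"
| "K0 n =
    (\<Sum>k<mm n 1. \<sigma> * (alpha n 1 k * (real n * \<mu>) ^ k + beta n 1 k * (real n * \<mu>) ^ k))
    + (2 * \<sigma>) ^ n * eta n 1"
| "K_below n j =
    (\<Sum>k<mm n j.
       alpha n j k * (exp (- 2 * real n * \<mu> / \<sigma>) * \<sigma> ^ (k + 1) * (-1) ^ k / 2 ^ (k + 1))
         * incr n j (\<lambda>y. inc_Gamma (1 + k) (- 2 * (y + real n * \<mu>) / \<sigma>))
       + beta n j k * incr n j (\<lambda>y. (y + real n * \<mu>) ^ (k + 1) / real (k + 1)))
    + eta n j * (2 * \<sigma>) ^ n * incr n j (\<lambda>y. exp (y / \<sigma>))"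
| "K_above n j =
    (\<Sum>k<mm n j.
       alpha n j k * incr n j (\<lambda>y. (y + real n * \<mu>) ^ (k + 1) / real (k + 1))
       - beta n j k * (exp (2 * real n * \<mu> / \<sigma>) * \<sigma> ^ (k + 1) / 2 ^ (k + 1))
         * incr n j (\<lambda>y. inc_Gamma (1 + k) (2 * (y + real n * \<mu>) / \<sigma>)))
    - eta n j * (2 * \<sigma>) ^ n * incr n j (\<lambda>y. exp (- y / \<sigma>))"

  by pat_completeness auto

termination by size_change

definition P_part :: "nat \<Rightarrow> nat \<Rightarrow> real \<Rightarrow> real" where
  "P_part i n x =
    ((\<Sum>j<mm n i. 1 / (2 ^ n * \<sigma> ^ (n - 1)) *
        (alpha n i j * (x + real n * \<mu>) ^ j * exp (x / \<sigma>)
         + beta n i j * (x + real n * \<mu>) ^ j * exp (- x / \<sigma>)))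
     + eta n i) * indicator (Ivl n i) x"

end

end

theory Submission
  imports Defs
begin

text \<open>
  Write \<open>p n x\<close> for the probability that the process started in \<open>x\<close> leaves \<open>[0, h)\<close> for the first time
  at step \<open>n\<close>. The first step leads from \<open>x\<close> to the point \<open>0\<close> with probability
  \<open>exp (- (x + \<mu>) / \<sigma>) / 2\<close>, because \<open>x + \<mu> > 0\<close> puts the half-line \<open>x + Z \<le> 0\<close> into the left tail of
  the Laplace law, and otherwise to \<open>y > 0\<close> with density \<open>exp (- \<bar>y - (x + \<mu>)\<bar> / \<sigma>) / (2 * \<sigma>)\<close>. Hence
  \<open>p (n + 1) x\<close> is the sum of \<open>exp (- (x + \<mu>) / \<sigma>) / 2 * p n 0\<close> and the integral over \<open>[0, h)\<close> of
  \<open>p n y * exp (- \<bar>y - (x + \<mu>)\<bar> / \<sigma>) / (2 * \<sigma>)\<close>, while \<open>p 1 x\<close> is a Laplace tail probability. The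
  theorem says that the piecewise expressions \<open>P_part\<close>, summed up in \<open>fet\<close> below, obey this recursion.

  On each cell of the partition, \<open>fet n\<close> is a constant plus polynomials times \<open>exp (\<plusminus>y / \<sigma>)\<close>. Below
  \<open>z = x + \<mu>\<close> the kernel is a multiple of \<open>exp (y / \<sigma>)\<close> and above it of \<open>exp (- y / \<sigma>)\<close>, so on every cell
  the integrand has an explicit primitive, \<open>prim_below\<close> or \<open>prim_above\<close>: multiplying \<open>exp (\<plusminus>y / \<sigma>)\<close> by the
  kernel leaves a pure power or a power times \<open>exp (\<plusminus>2 * y / \<sigma>)\<close>, and the latter integrates to an
  incomplete Gamma function (\<open>DERIV_prim_above\<close>, \<open>DERIV_prim_below\<close>). The constants \<open>K_below\<close> and
  \<open>K_above\<close> are the increments of these primitives over the cells entirely below or above \<open>z\<close>, and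
  \<open>K0\<close> is the contribution of the atom at \<open>0\<close>. Apart from the factors \<open>exp (\<plusminus>z / \<sigma>)\<close>,
  only the cell containing \<open>z\<close> contributes terms that depend on \<open>x\<close>. There the Gamma functions are evaluated at integer order, where
  they are polynomials times an exponential (\<open>inc_Gamma_Suc\<close>). All polynomials in \<open>x\<close> that arise are polynomials in
  \<open>z + n * \<mu> = x + (n + 1) * \<mu>\<close>, which explains the shape of the formula, and collecting them reproduces the
  recursion for \<open>alpha\<close> and \<open>beta\<close> (\<open>piece_Suc\<close>). The indices match because the cells at time
  \<open>n + 1\<close>, shifted by \<open>\<mu>\<close>, lie in cells at time \<open>n\<close> or beyond \<open>h\<close> (\<open>istar_eq\<close>).

  On the probabilistic side, independence turns the law of the first \<open>n + 1\<close> increments into a product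
  measure. There the increments are integrated out from the last one to the first: integrating the
  exit event over the last increment gives \<open>fet 1\<close> at the state before, and each further
  increment raises the index of \<open>fet\<close> by one (\<open>nn_integral_fet_survives\<close>). What remains at the end is
  \<open>fet (n + 1)\<close> at the starting point.
\<close>

declare alpha.simps [simp del] beta.simps [simp del] eta.simps [simp del]
  K0.simps [simp del] K_below.simps [simp del] K_above.simps [simp del]

section \<open>The incomplete Gamma function and the Laplace tail\<close>

lemma DERIV_exp_partial_sum:
  fixes y :: real
  shows "((\<lambda>y. fact k * exp (- y) * (\<Sum>j\<le>k. y ^ j / fact j))
    has_real_derivative - (y ^ k * exp (- y))) (at y)"
proof (induction k)
  case 0
  show ?case by (auto intro!: derivative_eq_intros)
next
  case (Suc k)
  have eq: "(\<lambda>y::real. fact (Suc k) * exp (- y) * (\<Sum>j\<le>Suc k. y ^ j / fact j))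
    = (\<lambda>y. real (Suc k) * (fact k * exp (- y) * (\<Sum>j\<le>k. y ^ j / fact j)) + y ^ Suc k * exp (- y))"
    by (rule ext) (simp add: field_simps del: of_nat_Suc)
  show ?case
    unfolding eq
    by (rule DERIV_cong[OF DERIV_add[OF DERIV_cmult[OF Suc]
            DERIV_mult[OF DERIV_pow DERIV_fun_exp[OF DERIV_minus[OF DERIV_ident]]]]])
      (simp add: algebra_simps)
qed

lemma tendsto_exp_partial_sum_at_top:
  "((\<lambda>y::real. fact k * exp (- y) * (\<Sum>j\<le>k. y ^ j / fact j)) \<longlongrightarrow> 0) at_top"
proof -
  have "((\<lambda>y::real. \<Sum>j\<le>k. fact k / fact j * (y ^ j / exp y)) \<longlongrightarrow> (\<Sum>j\<le>k. fact k / fact j * 0)) at_top"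
    by (intro tendsto_sum tendsto_mult tendsto_const tendsto_power_div_exp_0)
  then show ?thesis
    by (simp add: sum_distrib_left exp_minus field_simps)
qed

lemma inc_Gamma_Suc:
  "inc_Gamma (Suc k) y = fact k * exp (- y) * (\<Sum>j\<le>k. y ^ j / fact j)"
proof -
  define G where "G = (\<lambda>y::real. fact k * exp (- y) * (\<Sum>j\<le>k. y ^ j / fact j))"
  define g where "g = (\<lambda>t::real. t ^ k * exp (- t))"
  have dG: "((\<lambda>t. - G t) has_real_derivative g t) (at t)" for t
    unfolding G_def g_def using DERIV_minus[OF DERIV_exp_partial_sum[of k t]] by simp
  have lim: "((\<lambda>t. - G t) \<longlongrightarrow> 0) at_top"
    unfolding G_def using tendsto_minus[OF tendsto_exp_partial_sum_at_top[of k]] by simp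
  have cg: "isCont g t" for t unfolding g_def by (intro continuous_intros)
  have meas[measurable]: "g \<in> borel_measurable borel" unfolding g_def by measurable
  \<comment> \<open>For negative \<open>y\<close> and odd \<open>k\<close> the integrand changes sign at \<open>0\<close>. So integrability is checked on the half-line
    and on a compact interval separately, and only then the primitive is used.\<close>
  have int0: "set_integrable lborel {0..} g"
  proof -
    have "(\<integral>\<^sup>+t. ennreal (g t) * indicator {0..} t \<partial>lborel) = 0 - (- G 0)"
      by (rule nn_integral_FTC_atLeast) (use dG lim in \<open>auto simp: g_def\<close>)
    moreover have "ennreal (indicator {0..} t * g t) = ennreal (g t) * indicator {0..} t" for t
      by (simp add: indicator_def)
    ultimately have "(\<integral>\<^sup>+t. ennreal (indicator {0..} t * g t) \<partial>lborel) = ennreal (G 0)"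
      by simp
    then show ?thesis
      unfolding set_integrable_def
      by (intro integrableI_nonneg) (auto simp: g_def indicator_def)
  qed
  have int1: "set_integrable lborel {a..b} g" for a b
    by (rule borel_integrable_atLeastAtMost') (auto intro: continuous_at_imp_continuous_on cg)
  have "set_integrable lborel ({y..0} \<union> {0..}) g"
    by (intro set_integrable_Un int0 int1) auto
  then have int: "set_integrable lborel {y..} g"
    by (rule set_integrable_subset) auto
  have "((\<lambda>b. LINT t:{y..b}|lborel. g t) \<longlongrightarrow> (LINT t:{y..}|lborel. g t)) at_top"
    by (rule tendsto_set_lebesgue_integral_at_top[OF _ int]) auto
  moreover have "((\<lambda>b. LINT t:{y..b}|lborel. g t) \<longlongrightarrow> G y) at_top"
  proof -
    have ev: "\<forall>\<^sub>F b in at_top. - G b + G y = (LINT t:{y..b}|lborel. g t)"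
    proof (rule eventually_mono[OF eventually_ge_at_top[of y]])
      fix b assume "y \<le> b"
      from integral_FTC_Icc_real[OF this dG cg]
      show "- G b + G y = (LINT t:{y..b}|lborel. g t)"
        by (simp add: set_lebesgue_integral_def mult.commute)
    qed
    show ?thesis
      by (rule Lim_transform_eventually[OF _ ev]) (use tendsto_add[OF lim tendsto_const[of "G y"]] in simp)
  qed
  ultimately have "(LINT t:{y..}|lborel. g t) = G y"
    by (rule tendsto_unique[OF trivial_limit_at_top_linorder])
  then show ?thesis by (simp add: inc_Gamma_def g_def G_def)
qed

lemma DERIV_inc_Gamma:
  "(inc_Gamma (Suc k) has_real_derivative - (y ^ k * exp (- y))) (at y)"
proof -
  have "inc_Gamma (Suc k) = (\<lambda>y. fact k * exp (- y) * (\<Sum>j\<le>k. y ^ j / fact j))"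
    by (rule ext) (rule inc_Gamma_Suc)
  then show ?thesis by (simp add: DERIV_exp_partial_sum)
qed

text \<open>With \<open>s = - \<sigma> / 2\<close> and \<open>s = \<sigma> / 2\<close> this is the form in which the two Gamma terms of the recursion are
  expanded. The sum over \<open>j \<le> k\<close> collects the powers \<open>v ^ (j + 1)\<close> with, up to sign, the coefficients
  of the recursion for \<open>alpha\<close> and \<open>beta\<close>. It includes the power \<open>v ^ (k + 1)\<close>, which is absent from the Gamma
  function, where the partial sum of the exponential series stops at \<open>v ^ k\<close>. This is why that power is
  subtracted in front; it comes from integrating \<open>v ^ k\<close> without an exponential factor.\<close>

lemma inc_Gamma_scaled_expansion:
  fixes s v :: real
  assumes "s \<noteq> 0"
  shows "s ^ (k + 1) * inc_Gamma (Suc k) (v / s) = exp (- v / s) *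
    (fact k * s ^ (k + 1) - v ^ (k + 1) / real (k + 1)
     + (\<Sum>j\<le>k. s ^ (k - j) * (fact k / fact (Suc j)) * v ^ Suc j))"
proof -
  define a where "a j = s ^ (k + 1 - j) * (fact k / fact j) * v ^ j" for j
  have "(\<Sum>j\<le>Suc k. a j) = a 0 + (\<Sum>j\<le>k. a (Suc j))"
    by (rule sum.atMost_Suc_shift)
  moreover have "a (Suc k) = v ^ (k + 1) / real (k + 1)"
    by (simp add: a_def)
  moreover have "a 0 = fact k * s ^ (k + 1)" by (simp add: a_def)
  ultimately have "(\<Sum>j\<le>k. a j) = fact k * s ^ (k + 1) - v ^ (k + 1) / real (k + 1) + (\<Sum>j\<le>k. a (Suc j))"
    by simp
  moreover have "(\<Sum>j\<le>k. a j) = s ^ (k + 1) * (fact k * (\<Sum>j\<le>k. (v / s) ^ j / fact j))"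
    unfolding sum_distrib_left
  proof (rule sum.cong[OF refl])
    fix j assume "j \<in> {..k}"
    then have "s ^ (k + 1) = s ^ (k + 1 - j) * s ^ j" by (simp flip: power_add)
    then show "a j = s ^ (k + 1) * (fact k * ((v / s) ^ j / fact j))"
      using assms by (simp add: a_def power_divide)
  qed
  ultimately have sum: "s ^ (k + 1) * (fact k * (\<Sum>j\<le>k. (v / s) ^ j / fact j))
    = fact k * s ^ (k + 1) - v ^ (k + 1) / real (k + 1) + (\<Sum>j\<le>k. a (Suc j))"
    by simp
  have "s ^ (k + 1) * inc_Gamma (Suc k) (v / s)
    = exp (- v / s) * (s ^ (k + 1) * (fact k * (\<Sum>j\<le>k. (v / s) ^ j / fact j)))"
    by (simp add: inc_Gamma_Suc)
  then show ?thesis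
    unfolding sum by (simp add: a_def)
qed

lemma laplace_density_nonneg: "0 < \<sigma> \<Longrightarrow> 0 \<le> laplace_density \<mu> \<sigma> z"
  by (simp add: laplace_density_def)

lemma laplace_density_uminus:
  "laplace_density \<mu> \<sigma> (- z) = laplace_density (- \<mu>) \<sigma> z"
  using abs_minus_cancel[of "z + \<mu>"] by (simp add: laplace_density_def)

lemma borel_measurable_laplace_density [measurable]:
  "laplace_density \<mu> \<sigma> \<in> borel_measurable borel"
  unfolding laplace_density_def by measurable

text \<open>The tail probability of the Laplace law: see \<open>nn_integral_laplace_tail\<close>.\<close>

definition laplace_tail :: "real \<Rightarrow> real \<Rightarrow> real \<Rightarrow> real" where
  "laplace_tail \<mu> \<sigma> a =
    (if \<mu> \<le> a then exp (- (a - \<mu>) / \<sigma>) / 2 else 1 - exp ((a - \<mu>) / \<sigma>) / 2)"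

lemma laplace_tail_nonneg:
  assumes "0 < \<sigma>"
  shows "0 \<le> laplace_tail \<mu> \<sigma> a"
proof (cases "\<mu> \<le> a")
  case False
  then have "exp ((a - \<mu>) / \<sigma>) \<le> 1"
    unfolding exp_le_one_iff using assms by (simp add: divide_nonpos_pos)
  then have "0 \<le> 1 - exp ((a - \<mu>) / \<sigma>) / 2" by linarith
  then show ?thesis using False by (simp add: laplace_tail_def)
qed (simp add: laplace_tail_def)

lemma nn_integral_laplace_tail:
  assumes "0 < \<sigma>"
  shows "(\<integral>\<^sup>+z. ennreal (laplace_density \<mu> \<sigma> z) * indicator {a..} z \<partial>lborel)
    = ennreal (laplace_tail \<mu> \<sigma> a)"
proof -
  let ?f = "laplace_density \<mu> \<sigma>"
  have lim: "((\<lambda>z. - exp (- (z - \<mu>) / \<sigma>) / 2) \<longlongrightarrow> 0) at_top"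
    using assms by real_asymp
  have right: "(\<integral>\<^sup>+z. ennreal (?f z) * indicator {b..} z \<partial>lborel) = ennreal (exp (- (b - \<mu>) / \<sigma>) / 2)"
    if "\<mu> \<le> b" for b
  proof -
    have "(\<integral>\<^sup>+z. ennreal (?f z) * indicator {b..} z \<partial>lborel)
      = (\<integral>\<^sup>+z. ennreal (exp (- (z - \<mu>) / \<sigma>) / (2 * \<sigma>)) * indicator {b..} z \<partial>lborel)"
      using that by (intro nn_integral_cong)
        (auto simp: laplace_density_def indicator_def diff_divide_distrib)
    also have "\<dots> = 0 - (- exp (- (b - \<mu>) / \<sigma>) / 2)"
      by (rule nn_integral_FTC_atLeast[OF _ _ _ lim])
        (use assms in \<open>auto intro!: derivative_eq_intros simp: field_simps\<close>)
    finally show ?thesis by simp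
  qed
  show ?thesis
  proof (cases "\<mu> \<le> a")
    case True
    then show ?thesis using right[OF True] by (simp add: laplace_tail_def)
  next
    case False
    have left: "(\<integral>\<^sup>+z. ennreal (?f z) * indicator {a..\<mu>} z \<partial>lborel) = ennreal (1 / 2 - exp ((a - \<mu>) / \<sigma>) / 2)"
    proof -
      have "(\<integral>\<^sup>+z. ennreal (?f z) * indicator {a..\<mu>} z \<partial>lborel)
        = (\<integral>\<^sup>+z. ennreal (exp ((z - \<mu>) / \<sigma>) / (2 * \<sigma>)) * indicator {a..\<mu>} z \<partial>lborel)"
        by (intro nn_integral_cong) (auto simp: laplace_density_def indicator_def diff_divide_distrib)
      also have "\<dots> = ennreal (exp ((\<mu> - \<mu>) / \<sigma>) / 2 - exp ((a - \<mu>) / \<sigma>) / 2)"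
        by (rule nn_integral_FTC_Icc)
          (use assms False in \<open>auto intro!: derivative_eq_intros simp: field_simps\<close>)
      finally show ?thesis by simp
    qed
    have "(\<integral>\<^sup>+z. ennreal (?f z) * indicator {a..} z \<partial>lborel)
      = (\<integral>\<^sup>+z. ennreal (?f z) * indicator {a..\<mu>} z + ennreal (?f z) * indicator {\<mu>..} z \<partial>lborel)"
      using False
      by (intro nn_integral_cong_AE AE_I[where N="{\<mu>}"]) (auto simp: indicator_def)
    also have "\<dots> = ennreal (1 / 2 - exp ((a - \<mu>) / \<sigma>) / 2) + ennreal (1 / 2)"
      by (subst nn_integral_add) (auto simp: left right)
    also have "\<dots> = ennreal (laplace_tail \<mu> \<sigma> a)"
      using False assms
      by (subst ennreal_plus[symmetric]) (auto simp: laplace_tail_def divide_nonpos_pos)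
    finally show ?thesis .
  qed
qed

lemma nn_integral_laplace_left_tail:
  assumes "0 < \<sigma>"
  shows "(\<integral>\<^sup>+z. ennreal (laplace_density \<mu> \<sigma> z) * indicator {..a} z \<partial>lborel)
    = ennreal (laplace_tail (- \<mu>) \<sigma> (- a))"
proof -
  have "(\<integral>\<^sup>+z. ennreal (laplace_density \<mu> \<sigma> z) * indicator {..a} z \<partial>lborel)
    = (\<integral>\<^sup>+z. ennreal (laplace_density \<mu> \<sigma> (- z)) * indicator {..a} (- z) \<partial>lborel)"
    by (subst nn_integral_real_affine[where c="-1" and t=0]) auto
  also have "\<dots> = (\<integral>\<^sup>+z. ennreal (laplace_density (- \<mu>) \<sigma> z) * indicator {- a..} z \<partial>lborel)"
    by (intro nn_integral_cong) (auto simp: laplace_density_uminus indicator_def)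
  finally show ?thesis by (simp add: nn_integral_laplace_tail[OF assms])
qed

lemma sum_triangle_swap:
  fixes f :: "nat \<Rightarrow> nat \<Rightarrow> real"
  shows "(\<Sum>j<q. \<Sum>k = j..<q. f j k) = (\<Sum>k<q. \<Sum>j\<le>k. f j k)"
proof (induction q)
  case (Suc q)
  have "(\<Sum>j<Suc q. \<Sum>k = j..<Suc q. f j k) = (\<Sum>j<Suc q. (\<Sum>k = j..<q. f j k) + f j q)"
    by (intro sum.cong) auto
  also have "\<dots> = (\<Sum>k<Suc q. \<Sum>j\<le>k. f j k)"
    using Suc by (simp add: sum.distrib lessThan_Suc_atMost[symmetric])
  finally show ?case .
qed simp

section \<open>Exit times and paths\<close>

lemma exit_time_eq_iff:
  "exit_time h x Z \<omega> = enat n \<longleftrightarrow>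
    0 < n \<and> h \<le> lindley x Z n \<omega> \<and> (\<forall>k\<in>{1..<n}. lindley x Z k \<omega> < h)"
proof -
  let ?S = "{enat n | n. 0 < n \<and> h \<le> lindley x Z n \<omega>}"
  show ?thesis
  proof
    assume e: "exit_time h x Z \<omega> = enat n"
    then have I: "Inf ?S = enat n" by (simp add: exit_time_def)
    have "?S \<noteq> {}"
    proof
      assume "?S = {}"
      then have "Inf ?S = \<infinity>" by (simp only: Inf_enat_def simp_thms if_True)
      with I show False by simp
    qed
    then obtain y where "y \<in> ?S" by blast
    then have "(LEAST y. y \<in> ?S) \<in> ?S" by (rule LeastI)
    then have "Inf ?S \<in> ?S" using \<open>?S \<noteq> {}\<close> by (simp only: Inf_enat_def if_False)
    then have 1: "0 < n" "h \<le> lindley x Z n \<omega>" unfolding I by auto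
    have "lindley x Z k \<omega> < h" if "k \<in> {1..<n}" for k
    proof (rule ccontr)
      assume "\<not> lindley x Z k \<omega> < h"
      then have "enat k \<in> ?S" using that by auto
      then have "Inf ?S \<le> enat k" by (rule Inf_lower)
      then show False using that unfolding I by simp
    qed
    with 1 show "0 < n \<and> h \<le> lindley x Z n \<omega> \<and> (\<forall>k\<in>{1..<n}. lindley x Z k \<omega> < h)" by blast
  next
    assume a: "0 < n \<and> h \<le> lindley x Z n \<omega> \<and> (\<forall>k\<in>{1..<n}. lindley x Z k \<omega> < h)"
    then have "enat n \<in> ?S" by auto
    moreover have "enat n \<le> y" if "y \<in> ?S" for y
    proof -
      from that obtain k where "y = enat k" "0 < k" "h \<le> lindley x Z k \<omega>" by auto
      then show ?thesis using a by (metis One_nat_def Suc_le_eq atLeastLessThan_iff enat_ord_simps(1) not_le)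
    qed
    ultimately show "exit_time h x Z \<omega> = enat n"
      unfolding exit_time_def by (intro antisym Inf_lower Inf_greatest)
  qed
qed

lemma lindley_cong:
  assumes "\<And>i. 1 \<le> i \<Longrightarrow> i \<le> k \<Longrightarrow> Z i \<omega> = Z' i \<omega>'"
  shows "lindley x Z k \<omega> = lindley x Z' k \<omega>'"
  using assms by (induction k) auto

lemma lindley_nonneg: "0 \<le> x \<Longrightarrow> 0 \<le> lindley x Z k \<omega>"
  by (cases k) auto

section \<open>The partition\<close>

text \<open>Inside this locale the parameters are dropped from the notation: \<open>cells n\<close> is the number of
  intervals, \<open>cell n i\<close> is the \<open>i\<close>-th one with end points \<open>low n i\<close> and \<open>upp n i\<close>, and \<open>terms n i\<close> is the
  number of coefficients that belong to it.\<close>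

locale lindley_laplace =
  fixes \<mu> \<sigma> h :: real
  assumes sigma_pos: "0 < \<sigma>" and mu_pos: "0 < \<mu>" and mu_less: "\<mu> < h"
begin

abbreviation cells :: "nat \<Rightarrow> nat" where "cells \<equiv> ell \<mu> h"
abbreviation low :: "nat \<Rightarrow> nat \<Rightarrow> real" where "low \<equiv> lo \<mu> h"
abbreviation upp :: "nat \<Rightarrow> nat \<Rightarrow> real" where "upp \<equiv> up \<mu> h"
abbreviation cell :: "nat \<Rightarrow> nat \<Rightarrow> real set" where "cell \<equiv> Ivl \<mu> h"
abbreviation terms :: "nat \<Rightarrow> nat \<Rightarrow> nat" where "terms \<equiv> mm \<mu> h"
abbreviation star :: "nat \<Rightarrow> nat \<Rightarrow> nat" where "star \<equiv> istar \<mu> h"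
abbreviation al :: "nat \<Rightarrow> nat \<Rightarrow> nat \<Rightarrow> real" where "al \<equiv> alpha \<mu> \<sigma> h"
abbreviation be :: "nat \<Rightarrow> nat \<Rightarrow> nat \<Rightarrow> real" where "be \<equiv> beta \<mu> \<sigma> h"
abbreviation et :: "nat \<Rightarrow> nat \<Rightarrow> real" where "et \<equiv> eta \<mu> \<sigma> h"

definition max_cells :: nat where "max_cells = (LEAST r::nat. 0 < r \<and> h \<le> real r * \<mu>)"

lemma ell_eq: "cells n = min (n + 1) max_cells"
  by (simp add: ell_def max_cells_def)

lemma max_cells_mult_ge: "h \<le> real max_cells * \<mu>"
  and mult_less_if_less_max_cells: "r < max_cells \<Longrightarrow> real r * \<mu> < h"
  and max_cells_ge_2: "2 \<le> max_cells"
  using ell_least[OF mu_pos mu_less] unfolding max_cells_def by blast+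

lemma ell_ge_2: "1 \<le> n \<Longrightarrow> 2 \<le> cells n"
  using max_cells_ge_2 by (simp add: ell_eq)

lemma lo_first: "low n 1 = 0"
  by (simp add: lo_def)

lemma lo_Suc: "1 \<le> i \<Longrightarrow> low n (Suc i) = upp n i"
  by (simp add: lo_def up_def algebra_simps)

lemma up_last: "upp n (cells n) = h"
  by (simp add: up_def)

lemma lo_less_up:
  assumes "1 \<le> i" "i \<le> cells n"
  shows "low n i < upp n i"
proof (cases "i = 1")
  case True
  have "cells n - 1 < max_cells" using max_cells_ge_2 by (auto simp: ell_eq)
  from mult_less_if_less_max_cells[OF this] True assms show ?thesis
    by (simp add: lo_def up_def of_nat_diff)
next
  case False
  then show ?thesis using mu_pos by (simp add: lo_def up_def algebra_simps)
qed

lemma up_mono: "i \<le> j \<Longrightarrow> upp n i \<le> upp n j"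
  using mu_pos by (simp add: up_def)

lemma up_less_lo: "1 \<le> i \<Longrightarrow> i < j \<Longrightarrow> upp n i \<le> low n j"
  using lo_Suc[of "j - 1" n] up_mono[of i "j - 1" n] by (cases j) auto

lemma Ivl_cover:
  assumes "0 \<le> y" "y < h"
  obtains i where "i \<in> {1..cells n}" "y \<in> cell n i"
proof -
  have "\<exists>i \<in> {1..cells n}. y \<in> cell n i" if "y < upp n j" "1 \<le> j" "j \<le> cells n" for j
    using that(2,1,3)
  proof (induction j rule: dec_induct)
    case base
    then have "y \<in> cell n 1" using assms(1) by (simp add: Ivl_def lo_def)
    then show ?case using base by auto
  next
    case (step j)
    show ?case
    proof (cases "y < upp n j")
      case False
      then have "y \<in> cell n (Suc j)" using step by (simp add: Ivl_def lo_Suc)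
      then show ?thesis using step by auto
    qed (use step in auto)
  qed
  moreover have "1 \<le> cells n" using max_cells_ge_2 by (simp add: ell_eq)
  ultimately show ?thesis
    using assms(2) that by (metis order_refl up_last)
qed

lemma shift_index_istar:
  assumes "1 \<le> n" "i \<in> {1..cells (Suc n)}"
  shows "shift_index \<mu> h n i (star n i)"
  unfolding istar_def
  by (rule theI'[OF shift_index_ex1[OF mu_pos mu_less assms]])

lemma istar_cases:
  assumes "1 \<le> n" "i \<in> {1..cells (Suc n)}" "x \<in> cell (Suc n) i"
  obtains "h \<le> x + \<mu>" "star n i = cells n + 1"
  | "x + \<mu> < h" "star n i \<in> {1..cells n}" "x + \<mu> \<in> cell n (star n i)"
  using shift_index_istar[OF assms(1,2)] assms(3)
  unfolding shift_index_def by (cases "h \<le> x + \<mu>") auto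

text \<open>While the number of cells still grows, the cells at time \<open>n + 1\<close> are those at time \<open>n\<close> moved left by \<open>\<mu>\<close>
  (the first one cut off at \<open>0\<close>), followed by the new last cell \<open>[h - \<mu>, h)\<close>; so the index is kept.
  Once the number is constant, the partition no longer changes, and adding \<open>\<mu>\<close> leads from each cell
  into the next one. As the cells are disjoint, it suffices to look at the left end point of the cell.\<close>

lemma istar_eq:
  assumes "1 \<le> n" "i \<in> {1..cells (Suc n)}"
  shows "star n i = (if cells (Suc n) = cells n then i + 1 else i)" (is "_ = ?k")
proof -
  define x where "x = low (Suc n) i"
  have i: "1 \<le> i" "i \<le> cells (Suc n)" using assms(2) by auto
  have x: "x \<in> cell (Suc n) i" using lo_less_up[OF i] by (simp add: Ivl_def x_def)
  have L: "cells (Suc n) = cells n \<and> cells n = max_cells \<or> cells (Suc n) = cells n + 1"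
    by (auto simp: ell_eq)
  have up: "x + \<mu> < upp n ?k"
    using lo_less_up[OF i] L by (auto simp: x_def up_def algebra_simps)
  have lo: "low n ?k \<le> x + \<mu>"
    using i L mu_pos max_cells_mult_ge
    by (auto simp: x_def lo_def algebra_simps)
  show ?thesis
    using assms x
  proof (cases rule: istar_cases)
    case 1
    then have "h < upp n ?k" using up by simp
    then have "cells n < ?k" using up_mono[of ?k "cells n" n] unfolding up_last by linarith
    moreover have "?k \<le> cells n + 1" using i L by auto
    ultimately show ?thesis using 1 by simp
  next
    case 2
    have "x + \<mu> \<in> cell n ?k" using lo up by (simp add: Ivl_def)
    from Ivl_disjoint[OF mu_pos _ _ 2(3) this] show ?thesis using 2 i by auto
  qed
qed

lemma mm_Suc:
  assumes "1 \<le> n" "i \<in> {1..cells (Suc n)}"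
  shows "terms (Suc n) i = Suc (terms n (star n i))"
  using assms by (auto simp: istar_eq[OF assms] mm_def ell_eq)

section \<open>Primitives on the cells\<close>

text \<open>The expression that \<open>P_part\<close> restricts to a cell; as a function on the whole line it can be differentiated
  and evaluated at end points.\<close>

definition piece :: "nat \<Rightarrow> nat \<Rightarrow> real \<Rightarrow> real" where
  "piece n i x = (\<Sum>j<terms n i. 1 / (2 ^ n * \<sigma> ^ (n - 1)) *
     (al n i j * (x + real n * \<mu>) ^ j * exp (x / \<sigma>)
      + be n i j * (x + real n * \<mu>) ^ j * exp (- x / \<sigma>))) + et n i"

text \<open>Up to the factor \<open>2 ^ n * \<sigma> ^ (n - 1)\<close>, which clears the denominators in \<open>piece\<close>, this is a primitive of
  \<open>piece n i y * exp (- y / \<sigma>)\<close>, and the next one of \<open>piece n i y * exp (y / \<sigma>)\<close>.\<close>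

definition prim_above :: "nat \<Rightarrow> nat \<Rightarrow> real \<Rightarrow> real" where
  "prim_above n i y =
    (\<Sum>k<terms n i. al n i k * ((y + real n * \<mu>) ^ (k + 1) / real (k + 1))
      - be n i k * (exp (2 * real n * \<mu> / \<sigma>) * \<sigma> ^ (k + 1) / 2 ^ (k + 1))
        * inc_Gamma (1 + k) (2 * (y + real n * \<mu>) / \<sigma>))
    - et n i * (2 * \<sigma>) ^ n * exp (- y / \<sigma>)"

definition prim_below :: "nat \<Rightarrow> nat \<Rightarrow> real \<Rightarrow> real" where
  "prim_below n i y =
    (\<Sum>k<terms n i. al n i k * (exp (- 2 * real n * \<mu> / \<sigma>) * \<sigma> ^ (k + 1) * (-1) ^ k / 2 ^ (k + 1))
        * inc_Gamma (1 + k) (- 2 * (y + real n * \<mu>) / \<sigma>)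
      + be n i k * ((y + real n * \<mu>) ^ (k + 1) / real (k + 1)))
    + et n i * (2 * \<sigma>) ^ n * exp (y / \<sigma>)"

lemma K_above_eq: "K_above \<mu> \<sigma> h n j = prim_above n j (upp n j) - prim_above n j (low n j)"
  unfolding K_above.simps prim_above_def incr_def right_diff_distrib sum_subtractf
  by simp

lemma K_below_eq: "K_below \<mu> \<sigma> h n j = prim_below n j (upp n j) - prim_below n j (low n j)"
  unfolding K_below.simps prim_below_def incr_def right_diff_distrib sum_subtractf sum.distrib
  by simp

text \<open>The exponential factor \<open>exp (2 * n * \<mu> / \<sigma>)\<close> in the primitive compensates that the Gamma function is evaluated at
  the shifted point \<open>y + n * \<mu>\<close>.\<close>

lemma DERIV_prim_above:
  assumes "1 \<le> n"
  shows "(prim_above n i has_real_derivative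
    2 ^ n * \<sigma> ^ (n - 1) * (piece n i y * exp (- y / \<sigma>))) (at y)"
proof -
  let ?u = "y + real n * \<mu>"
  have poly: "((\<lambda>y. (y + real n * \<mu>) ^ (k + 1) / real (k + 1)) has_real_derivative ?u ^ k) (at y)" for k
    by (rule DERIV_cong[OF DERIV_cdivide[OF DERIV_power[OF DERIV_add[OF DERIV_ident DERIV_const]]]])
      (simp add: field_simps)
  have e: "exp (2 * real n * \<mu> / \<sigma>) * exp (- (2 * ?u / \<sigma>)) = exp (- y / \<sigma>) * exp (- y / \<sigma>)"
    by (simp add: exp_add[symmetric] add_divide_distrib[symmetric] diff_divide_distrib[symmetric] algebra_simps flip: exp_add)
  have G: "((\<lambda>y. exp (2 * real n * \<mu> / \<sigma>) * \<sigma> ^ (k + 1) / 2 ^ (k + 1)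
      * inc_Gamma (1 + k) (2 * (y + real n * \<mu>) / \<sigma>)) has_real_derivative
      - (?u ^ k * (exp (- y / \<sigma>) * exp (- y / \<sigma>)))) (at y)" for k
  proof -
    have "((\<lambda>y. inc_Gamma (Suc k) (2 * (y + real n * \<mu>) / \<sigma>)) has_real_derivative
      - ((2 * ?u / \<sigma>) ^ k * exp (- (2 * ?u / \<sigma>))) * (2 / \<sigma>)) (at y)"
      using sigma_pos by (intro DERIV_chain2[OF DERIV_inc_Gamma]) (auto intro!: derivative_eq_intros)
    then have "((\<lambda>y. exp (2 * real n * \<mu> / \<sigma>) * \<sigma> ^ (k + 1) / 2 ^ (k + 1)
      * inc_Gamma (1 + k) (2 * (y + real n * \<mu>) / \<sigma>)) has_real_derivative
      exp (2 * real n * \<mu> / \<sigma>) * \<sigma> ^ (k + 1) / 2 ^ (k + 1) *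
      (- ((2 * ?u / \<sigma>) ^ k * exp (- (2 * ?u / \<sigma>))) * (2 / \<sigma>))) (at y)"
      by (intro DERIV_cmult) simp
    also have "exp (2 * real n * \<mu> / \<sigma>) * \<sigma> ^ (k + 1) / 2 ^ (k + 1) *
      (- ((2 * ?u / \<sigma>) ^ k * exp (- (2 * ?u / \<sigma>))) * (2 / \<sigma>))
      = - (?u ^ k * (exp (2 * real n * \<mu> / \<sigma>) * exp (- (2 * ?u / \<sigma>))))"
    proof -
      have p: "(2 * ?u / \<sigma>) ^ k = 2 ^ k * ?u ^ k / \<sigma> ^ k"
        by (simp only: power_mult_distrib power_divide)
      show ?thesis unfolding p using sigma_pos by simp
    qed
    finally show ?thesis by (simp only: e)
  qed
  have E: "((\<lambda>y. (2 * \<sigma>) ^ n * exp (- y / \<sigma>)) has_real_derivative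
      - (2 ^ n * \<sigma> ^ (n - 1) * exp (- y / \<sigma>))) (at y)"
    using assms sigma_pos
    by (cases n) (auto intro!: derivative_eq_intros simp: power_mult_distrib)
  have "(prim_above n i has_real_derivative
    (\<Sum>k<terms n i. al n i k * ?u ^ k - be n i k * - (?u ^ k * (exp (- y / \<sigma>) * exp (- y / \<sigma>))))
     - et n i * - (2 ^ n * \<sigma> ^ (n - 1) * exp (- y / \<sigma>))) (at y)"
    unfolding prim_above_def[abs_def] mult.assoc[of "be _ _ _"] mult.assoc[of "et _ _"]
    by (intro DERIV_diff DERIV_sum DERIV_cmult poly G E)
  also have "(\<Sum>k<terms n i. al n i k * ?u ^ k - be n i k * - (?u ^ k * (exp (- y / \<sigma>) * exp (- y / \<sigma>))))
     - et n i * - (2 ^ n * \<sigma> ^ (n - 1) * exp (- y / \<sigma>))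
    = 2 ^ n * \<sigma> ^ (n - 1) * (piece n i y * exp (- y / \<sigma>))"
  proof -
    have "2 ^ n * \<sigma> ^ (n - 1) * (1 / (2 ^ n * \<sigma> ^ (n - 1)) *
     (a * exp (y / \<sigma>) + b * exp (- y / \<sigma>)) * exp (- y / \<sigma>))
      = a + b * (exp (- y / \<sigma>) * exp (- y / \<sigma>))" for a b
    proof -
      have "(a * exp (y / \<sigma>) + b * exp (- y / \<sigma>)) * exp (- y / \<sigma>)
        = a * (exp (y / \<sigma>) * exp (- y / \<sigma>)) + b * (exp (- y / \<sigma>) * exp (- y / \<sigma>))"
        by algebra
      then show ?thesis using sigma_pos by (simp add: exp_minus_inverse)
    qed
    note this[of "al n i k * ?u ^ k" "be n i k * ?u ^ k" for k]
    then show ?thesis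
      unfolding piece_def distrib_left distrib_right sum_distrib_left sum_distrib_right
      by (simp add: algebra_simps)
  qed
  finally show ?thesis .
qed

lemma DERIV_prim_below:
  assumes "1 \<le> n"
  shows "(prim_below n i has_real_derivative
    2 ^ n * \<sigma> ^ (n - 1) * (piece n i y * exp (y / \<sigma>))) (at y)"
proof -
  let ?u = "y + real n * \<mu>"
  have poly: "((\<lambda>y. (y + real n * \<mu>) ^ (k + 1) / real (k + 1)) has_real_derivative ?u ^ k) (at y)" for k
    by (rule DERIV_cong[OF DERIV_cdivide[OF DERIV_power[OF DERIV_add[OF DERIV_ident DERIV_const]]]])
      (simp add: field_simps)
  have e: "exp (- 2 * real n * \<mu> / \<sigma>) * exp (- (- 2 * ?u / \<sigma>)) = exp (y / \<sigma>) * exp (y / \<sigma>)"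
    by (simp add: exp_add[symmetric] add_divide_distrib[symmetric] diff_divide_distrib[symmetric] algebra_simps flip: exp_add)
  have G: "((\<lambda>y. exp (- 2 * real n * \<mu> / \<sigma>) * \<sigma> ^ (k + 1) * (-1) ^ k / 2 ^ (k + 1)
      * inc_Gamma (1 + k) (- 2 * (y + real n * \<mu>) / \<sigma>)) has_real_derivative
      ?u ^ k * (exp (y / \<sigma>) * exp (y / \<sigma>))) (at y)" for k
  proof -
    have "((\<lambda>y. inc_Gamma (Suc k) (- 2 * (y + real n * \<mu>) / \<sigma>)) has_real_derivative
      - ((- 2 * ?u / \<sigma>) ^ k * exp (- (- 2 * ?u / \<sigma>))) * (- 2 / \<sigma>)) (at y)"
      using sigma_pos by (intro DERIV_chain2[OF DERIV_inc_Gamma]) (auto intro!: derivative_eq_intros)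
    then have "((\<lambda>y. exp (- 2 * real n * \<mu> / \<sigma>) * \<sigma> ^ (k + 1) * (-1) ^ k / 2 ^ (k + 1)
      * inc_Gamma (1 + k) (- 2 * (y + real n * \<mu>) / \<sigma>)) has_real_derivative
      exp (- 2 * real n * \<mu> / \<sigma>) * \<sigma> ^ (k + 1) * (-1) ^ k / 2 ^ (k + 1) *
      (- ((- 2 * ?u / \<sigma>) ^ k * exp (- (- 2 * ?u / \<sigma>))) * (- 2 / \<sigma>))) (at y)"
      by (intro DERIV_cmult) simp
    also have "exp (- 2 * real n * \<mu> / \<sigma>) * \<sigma> ^ (k + 1) * (-1) ^ k / 2 ^ (k + 1) *
      (- ((- 2 * ?u / \<sigma>) ^ k * exp (- (- 2 * ?u / \<sigma>))) * (- 2 / \<sigma>))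
      = ?u ^ k * (exp (- 2 * real n * \<mu> / \<sigma>) * exp (- (- 2 * ?u / \<sigma>)))"
    proof -
      have "(- 2 * ?u / \<sigma>) ^ k = (-1) ^ k * (2 ^ k * ?u ^ k / \<sigma> ^ k)"
      proof -
        have "(- 2 * ?u / \<sigma>) ^ k = ((-1) * (2 * ?u / \<sigma>)) ^ k" by simp
        then show ?thesis by (simp only: power_mult_distrib power_divide)
      qed
      moreover have "(-1::real) ^ k * (-1) ^ k = 1" by (simp flip: power_mult_distrib)
      then have "\<sigma> ^ (k + 1) * (-1) ^ k / 2 ^ (k + 1) * ((-1) ^ k * (2 ^ k * ?u ^ k / \<sigma> ^ k) * (2 / \<sigma>)) = ?u ^ k"
        using sigma_pos by (simp add: field_simps)
      ultimately show ?thesis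
        using sigma_pos by (simp add: algebra_simps)
    qed
    finally show ?thesis by (simp only: e)
  qed
  have E: "((\<lambda>y. (2 * \<sigma>) ^ n * exp (y / \<sigma>)) has_real_derivative
      2 ^ n * \<sigma> ^ (n - 1) * exp (y / \<sigma>)) (at y)"
    using assms sigma_pos
    by (cases n) (auto intro!: derivative_eq_intros simp: power_mult_distrib)
  have "(prim_below n i has_real_derivative
    (\<Sum>k<terms n i. al n i k * (?u ^ k * (exp (y / \<sigma>) * exp (y / \<sigma>))) + be n i k * ?u ^ k)
     + et n i * (2 ^ n * \<sigma> ^ (n - 1) * exp (y / \<sigma>))) (at y)"
    unfolding prim_below_def[abs_def] mult.assoc[of "al _ _ _"] mult.assoc[of "et _ _"]
    by (intro DERIV_add DERIV_sum DERIV_cmult poly G E)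
  also have "(\<Sum>k<terms n i. al n i k * (?u ^ k * (exp (y / \<sigma>) * exp (y / \<sigma>))) + be n i k * ?u ^ k)
     + et n i * (2 ^ n * \<sigma> ^ (n - 1) * exp (y / \<sigma>))
    = 2 ^ n * \<sigma> ^ (n - 1) * (piece n i y * exp (y / \<sigma>))"
  proof -
    have "2 ^ n * \<sigma> ^ (n - 1) * (1 / (2 ^ n * \<sigma> ^ (n - 1)) *
     (a * exp (y / \<sigma>) + b * exp (- y / \<sigma>)) * exp (y / \<sigma>))
      = a * (exp (y / \<sigma>) * exp (y / \<sigma>)) + b" for a b
    proof -
      have "(a * exp (y / \<sigma>) + b * exp (- y / \<sigma>)) * exp (y / \<sigma>)
        = a * (exp (y / \<sigma>) * exp (y / \<sigma>)) + b * (exp (- y / \<sigma>) * exp (y / \<sigma>))"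
        by algebra
      then show ?thesis using sigma_pos by (simp add: exp_minus)
    qed
    note this[of "al n i k * ?u ^ k" "be n i k * ?u ^ k" for k]
    then show ?thesis
      unfolding piece_def distrib_left distrib_right sum_distrib_left sum_distrib_right
      by (simp add: algebra_simps)
  qed
  finally show ?thesis .
qed

section \<open>Integration against the kernel\<close>

text \<open>The claimed distribution of the first exit time, as a function of the starting point.\<close>

definition fet :: "nat \<Rightarrow> real \<Rightarrow> real" where
  "fet n x = (\<Sum>i = 1..cells n. P_part \<mu> \<sigma> h i n x)"

lemma P_part_eq: "P_part \<mu> \<sigma> h i n x = piece n i x * indicator (cell n i) x"
  by (simp add: P_part_def piece_def)

lemma fet_eq_piece:
  assumes "i \<in> {1..cells n}" "x \<in> cell n i"
  shows "fet n x = piece n i x"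
proof -
  have "fet n x = (\<Sum>l = 1..cells n. if l = i then piece n i x else 0)"
    unfolding fet_def P_part_eq using assms Ivl_disjoint[OF mu_pos]
    by (intro sum.cong) (fastforce simp: indicator_def)+
  then show ?thesis using assms by simp
qed

text \<open>The integrand may jump at the end points of a cell, so the fundamental theorem is used in the form that
  asks for the derivative in the open interval only.\<close>

lemma has_integral_below_piece:
  assumes "1 \<le> n" "i \<in> {1..cells n}" "low n i \<le> a" "a \<le> b" "b \<le> upp n i" "b \<le> z"
  shows "((\<lambda>y. fet n y * exp (- \<bar>y - z\<bar> / \<sigma>)) has_integral
    exp (- z / \<sigma>) * (prim_below n i b - prim_below n i a) / (2 ^ n * \<sigma> ^ (n - 1))) {a..b}"
proof -
  let ?c = "2 ^ n * \<sigma> ^ (n - 1)"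
  let ?F = "\<lambda>y. exp (- z / \<sigma>) / ?c * prim_below n i y"
  have D: "(?F has_real_derivative exp (- z / \<sigma>) / ?c * (?c * (piece n i y * exp (y / \<sigma>)))) (at y)" for y
    by (intro DERIV_cmult DERIV_prim_below assms)
  have "((\<lambda>y. fet n y * exp (- \<bar>y - z\<bar> / \<sigma>)) has_integral ?F b - ?F a) {a..b}"
  proof (rule fundamental_theorem_of_calculus_interior[OF \<open>a \<le> b\<close>])
    show "continuous_on {a..b} ?F"
      using D by (intro continuous_at_imp_continuous_on ballI) (rule DERIV_isCont)
    fix y assume y: "y \<in> {a<..<b}"
    then have "y \<in> cell n i" using assms by (auto simp: Ivl_def)
    then have "fet n y = piece n i y" by (rule fet_eq_piece[OF assms(2)])
    moreover have "exp (- \<bar>y - z\<bar> / \<sigma>) = exp (- z / \<sigma>) * exp (y / \<sigma>)"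
      using y assms by (simp add: diff_divide_distrib flip: exp_add)
    ultimately show "(?F has_vector_derivative fet n y * exp (- \<bar>y - z\<bar> / \<sigma>)) (at y)"
      using D[of y] sigma_pos
      by (simp add: has_real_derivative_iff_has_vector_derivative[symmetric] mult_ac)
  qed
  then show ?thesis by (simp add: right_diff_distrib diff_divide_distrib)
qed

lemma has_integral_above_piece:
  assumes "1 \<le> n" "i \<in> {1..cells n}" "low n i \<le> a" "a \<le> b" "b \<le> upp n i" "z \<le> a"
  shows "((\<lambda>y. fet n y * exp (- \<bar>y - z\<bar> / \<sigma>)) has_integral
    exp (z / \<sigma>) * (prim_above n i b - prim_above n i a) / (2 ^ n * \<sigma> ^ (n - 1))) {a..b}"
proof -
  let ?c = "2 ^ n * \<sigma> ^ (n - 1)"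
  let ?F = "\<lambda>y. exp (z / \<sigma>) / ?c * prim_above n i y"
  have D: "(?F has_real_derivative exp (z / \<sigma>) / ?c * (?c * (piece n i y * exp (- y / \<sigma>)))) (at y)" for y
    by (intro DERIV_cmult DERIV_prim_above assms)
  have "((\<lambda>y. fet n y * exp (- \<bar>y - z\<bar> / \<sigma>)) has_integral ?F b - ?F a) {a..b}"
  proof (rule fundamental_theorem_of_calculus_interior[OF \<open>a \<le> b\<close>])
    show "continuous_on {a..b} ?F"
      using D by (intro continuous_at_imp_continuous_on ballI) (rule DERIV_isCont)
    fix y assume y: "y \<in> {a<..<b}"
    then have "y \<in> cell n i" using assms by (auto simp: Ivl_def)
    then have "fet n y = piece n i y" by (rule fet_eq_piece[OF assms(2)])
    moreover have "exp (- \<bar>y - z\<bar> / \<sigma>) = exp (z / \<sigma>) * exp (- y / \<sigma>)"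
      using y assms by (simp add: diff_divide_distrib flip: exp_add)
    ultimately show "(?F has_vector_derivative fet n y * exp (- \<bar>y - z\<bar> / \<sigma>)) (at y)"
      using D[of y] sigma_pos
      by (simp add: has_real_derivative_iff_has_vector_derivative[symmetric] mult_ac)
  qed
  then show ?thesis by (simp add: right_diff_distrib diff_divide_distrib)
qed

lemma has_integral_below:
  assumes "1 \<le> n" "1 \<le> j" "j \<le> cells n + 1" "low n j \<le> z"
  shows "((\<lambda>y. fet n y * exp (- \<bar>y - z\<bar> / \<sigma>)) has_integral
    exp (- z / \<sigma>) * (\<Sum>l = 1..<j. K_below \<mu> \<sigma> h n l) / (2 ^ n * \<sigma> ^ (n - 1))) {0..low n j}"
  using assms(2-4)
proof (induction j rule: dec_induct)
  case base
  then show ?case by (simp add: lo_def has_integral_refl)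
next
  case (step j)
  have j: "j \<in> {1..cells n}" and lu: "low n j < upp n j"
    using step lo_less_up[of j n] by auto
  have 0: "0 \<le> low n j"
    using lo_first[of n] lo_less_up[of 1 n] up_less_lo[of 1 j n] j by (cases "j = 1") auto
  have s: "low n (Suc j) = upp n j" using step by (simp add: lo_Suc)
  have IH: "((\<lambda>y. fet n y * exp (- \<bar>y - z\<bar> / \<sigma>)) has_integral
    exp (- z / \<sigma>) * (\<Sum>l = 1..<j. K_below \<mu> \<sigma> h n l) / (2 ^ n * \<sigma> ^ (n - 1))) {0..low n j}"
    using step s lu by simp
  have "((\<lambda>y. fet n y * exp (- \<bar>y - z\<bar> / \<sigma>)) has_integral
    exp (- z / \<sigma>) * K_below \<mu> \<sigma> h n j / (2 ^ n * \<sigma> ^ (n - 1))) {low n j..upp n j}"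
    unfolding K_below_eq using step s lu j assms(1) by (intro has_integral_below_piece) auto
  from has_integral_combine[OF 0 less_imp_le[OF lu] IH this] show ?case
    using step by (simp add: s distrib_left add_divide_distrib)
qed

lemma has_integral_above:
  assumes "1 \<le> n" "1 \<le> j" "j \<le> cells n" "z \<le> upp n j"
  shows "((\<lambda>y. fet n y * exp (- \<bar>y - z\<bar> / \<sigma>)) has_integral
    exp (z / \<sigma>) * (\<Sum>l = j + 1..cells n. K_above \<mu> \<sigma> h n l) / (2 ^ n * \<sigma> ^ (n - 1))) {upp n j..h}"
  using assms(3,2,4)
proof (induction j rule: inc_induct)
  case base
  then show ?case by (simp add: up_last has_integral_refl)
next
  case (step j)
  have j: "Suc j \<in> {1..cells n}" and s: "low n (Suc j) = upp n j"
    using step by (auto simp: lo_Suc)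
  have lu: "upp n j \<le> upp n (Suc j)" "upp n (Suc j) \<le> h"
    using up_mono[of j "Suc j" n] up_mono[of "Suc j" "cells n" n] j by (auto simp: up_last)
  have IH: "((\<lambda>y. fet n y * exp (- \<bar>y - z\<bar> / \<sigma>)) has_integral
    exp (z / \<sigma>) * (\<Sum>l = Suc j + 1..cells n. K_above \<mu> \<sigma> h n l) / (2 ^ n * \<sigma> ^ (n - 1))) {upp n (Suc j)..h}"
    using step lu by simp
  have "((\<lambda>y. fet n y * exp (- \<bar>y - z\<bar> / \<sigma>)) has_integral
    exp (z / \<sigma>) * K_above \<mu> \<sigma> h n (Suc j) / (2 ^ n * \<sigma> ^ (n - 1))) {upp n j..upp n (Suc j)}"
    unfolding K_above_eq s using step s lu j assms(1) by (intro has_integral_above_piece) auto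
  from has_integral_combine[OF lu this IH]
  show ?case
    using step(1,2) by (simp add: sum.atLeast_Suc_atMost[of "Suc j"] distrib_left add_divide_distrib)
qed

text \<open>The index \<open>cells n + 1\<close> stands for \<open>x + \<mu> \<ge> h\<close>, when all of \<open>[0, h)\<close> lies below \<open>x + \<mu>\<close> and no cell has to
  be split. The primitives vanish for this index, so that this case obeys the same formulas as
  the others.\<close>

lemma eta_beyond:
  assumes "1 \<le> n"
  shows "et n (cells n + 1) = 0"
proof (cases n)
  case (Suc n')
  then show ?thesis using ell_ge_2[of 1] by (cases "n' = 0") (auto simp: eta.simps)
qed (use assms in simp)

lemma prim_beyond:
  assumes "1 \<le> n"
  shows "prim_below n (cells n + 1) y = 0" "prim_above n (cells n + 1) y = 0"
  using eta_beyond[OF assms] by (simp_all add: prim_below_def prim_above_def mm_def)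

text \<open>Cells below \<open>z\<close> contribute \<open>K_below\<close>, cells above \<open>z\<close> contribute \<open>K_above\<close>, and the cell with index \<open>k\<close> is cut
  at \<open>z\<close>.\<close>

lemma has_integral_fet_kernel:
  assumes n: "1 \<le> n" and k: "h \<le> z \<and> k = cells n + 1 \<or> k \<in> {1..cells n} \<and> z \<in> cell n k"
  shows "((\<lambda>y. fet n y * exp (- \<bar>y - z\<bar> / \<sigma>)) has_integral
    (exp (- z / \<sigma>) * ((\<Sum>l = 1..<k. K_below \<mu> \<sigma> h n l) + prim_below n k z - prim_below n k (low n k))
     + exp (z / \<sigma>) * ((\<Sum>l = k + 1..cells n. K_above \<mu> \<sigma> h n l) + prim_above n k (upp n k) - prim_above n k z))
    / (2 ^ n * \<sigma> ^ (n - 1))) {0..h}"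
  using k
proof
  assume k: "h \<le> z \<and> k = cells n + 1"
  have "1 \<le> cells n" using ell_ge_2[OF n] by simp
  then have "low n (cells n + 1) = h" using lo_Suc[of "cells n" n] by (simp add: up_last)
  with has_integral_below[of n "cells n + 1" z] k n show ?thesis
    unfolding prim_beyond[OF n] conjunct2[OF k] by simp
next
  assume k: "k \<in> {1..cells n} \<and> z \<in> cell n k"
  then have z: "low n k \<le> z" "z \<le> upp n k" by (auto simp: Ivl_def)
  have 0: "0 \<le> low n k"
    using lo_first[of n] lo_less_up[of 1 n] up_less_lo[of 1 k n] k by (cases "k = 1") auto
  have 1: "upp n k \<le> h" using up_mono[of k "cells n" n] k by (simp add: up_last)
  note a = has_integral_below[OF n _ _ z(1)]
  note b = has_integral_below_piece[OF n conjunct1[OF k] order_refl z order_refl]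
  note c = has_integral_above_piece[OF n conjunct1[OF k] z order_refl order_refl]
  note d = has_integral_above[OF n _ _ z(2)]
  have "((\<lambda>y. fet n y * exp (- \<bar>y - z\<bar> / \<sigma>)) has_integral
    exp (- z / \<sigma>) * (\<Sum>l = 1..<k. K_below \<mu> \<sigma> h n l) / (2 ^ n * \<sigma> ^ (n - 1))
    + exp (- z / \<sigma>) * (prim_below n k z - prim_below n k (low n k)) / (2 ^ n * \<sigma> ^ (n - 1))
    + (exp (z / \<sigma>) * (prim_above n k (upp n k) - prim_above n k z) / (2 ^ n * \<sigma> ^ (n - 1))
    + exp (z / \<sigma>) * (\<Sum>l = k + 1..cells n. K_above \<mu> \<sigma> h n l) / (2 ^ n * \<sigma> ^ (n - 1)))) {0..h}"
    using k z 0 1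
    by (intro has_integral_combine[of 0 z h] has_integral_combine[of 0 "low n k" z]
        has_integral_combine[of z "upp n k" h] a b c d) auto
  then show ?thesis
    by (simp add: algebra_simps add_divide_distrib diff_divide_distrib)
qed

lemma K0_eq:
  assumes "1 \<le> n"
  shows "K0 \<mu> \<sigma> h n = (2 * \<sigma>) ^ n * piece n 1 0"
proof -
  have "(2 * \<sigma>) ^ n / (2 ^ n * \<sigma> ^ (n - 1)) = \<sigma>"
    using assms sigma_pos by (cases n) (auto simp: power_mult_distrib)
  then show ?thesis
    unfolding K0.simps piece_def distrib_left[of "(2 * \<sigma>) ^ n"] sum_distrib_left
    by (simp flip: times_divide_eq_left mult.assoc) 
qed

section \<open>The recursion for the coefficients\<close>

text \<open>This is the contribution of the cut itself. The exponentials produced by the Gamma functions turn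
  the outer factors \<open>exp (- z / \<sigma>)\<close> and \<open>exp (z / \<sigma>)\<close> around: what \<open>alpha\<close> contributes is a polynomial
  times \<open>exp (z / \<sigma>)\<close> from both sides of the cut, and likewise \<open>beta\<close> with \<open>exp (- z / \<sigma>)\<close>. Therefore the class of functions
  is preserved by the recursion, with the degree raised by one.\<close>

lemma kernel_primitives:
  fixes x :: real
  assumes n: "1 \<le> n"
  defines "z \<equiv> x + \<mu>"
  defines "v \<equiv> z + real n * \<mu>"
  shows "exp (- z / \<sigma>) * prim_below n k z - exp (z / \<sigma>) * prim_above n k z =
    exp (z / \<sigma>) * (\<Sum>l<terms n k. al n k l * (fact l * (\<sigma> ^ (l + 1) * (-1) ^ l / 2 ^ (l + 1))
       - (\<Sum>j\<le>l. (- \<sigma> / 2) ^ (l - j) * (fact l / fact (Suc j)) * v ^ Suc j)))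
    + exp (- z / \<sigma>) * (\<Sum>l<terms n k. be n k l * (fact l * (\<sigma> ^ (l + 1) / 2 ^ (l + 1))
       + (\<Sum>j\<le>l. (\<sigma> / 2) ^ (l - j) * (fact l / fact (Suc j)) * v ^ Suc j)))
    + 2 * (2 * \<sigma>) ^ n * et n k"
proof -
  let ?S = "\<lambda>s l. \<Sum>j\<le>l. s ^ (l - j) * (fact l / fact (Suc j)) * v ^ Suc j"
  have A: "exp (- z / \<sigma>) * (exp (- 2 * real n * \<mu> / \<sigma>) * \<sigma> ^ (l + 1) * (-1) ^ l / 2 ^ (l + 1)
       * inc_Gamma (1 + l) (- 2 * v / \<sigma>)) - exp (z / \<sigma>) * (v ^ (l + 1) / real (l + 1))
     = exp (z / \<sigma>) * (fact l * (\<sigma> ^ (l + 1) * (-1) ^ l / 2 ^ (l + 1)) - ?S (- \<sigma> / 2) l)" for l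
  proof -
    have s: "\<sigma> ^ (l + 1) * (-1) ^ l / 2 ^ (l + 1) = - ((- \<sigma> / 2) ^ (l + 1))"
    proof -
      have "(- \<sigma> / 2) ^ (l + 1) = ((-1) * (\<sigma> / 2)) ^ (l + 1)" by simp
      then show ?thesis by (simp only: power_mult_distrib power_divide) simp
    qed
    have e: "exp (- z / \<sigma>) * exp (- 2 * real n * \<mu> / \<sigma>) * exp (- v / (- \<sigma> / 2)) = exp (z / \<sigma>)"
      unfolding exp_add[symmetric] v_def using sigma_pos by (simp add: field_simps)
    have g: "(- \<sigma> / 2) ^ (l + 1) * inc_Gamma (1 + l) (- 2 * v / \<sigma>) = exp (- v / (- \<sigma> / 2)) *
      (fact l * (- \<sigma> / 2) ^ (l + 1) - v ^ (l + 1) / real (l + 1) + ?S (- \<sigma> / 2) l)"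
      using inc_Gamma_scaled_expansion[of "- \<sigma> / 2" l v] sigma_pos by (simp add: mult.commute)
    have "exp (- z / \<sigma>) * (exp (- 2 * real n * \<mu> / \<sigma>) * \<sigma> ^ (l + 1) * (-1) ^ l / 2 ^ (l + 1)
         * inc_Gamma (1 + l) (- 2 * v / \<sigma>))
      = exp (- z / \<sigma>) * exp (- 2 * real n * \<mu> / \<sigma>)
         * ((\<sigma> ^ (l + 1) * (-1) ^ l / 2 ^ (l + 1)) * inc_Gamma (1 + l) (- 2 * v / \<sigma>))"
      by simp
    also have "\<dots> = - (exp (- z / \<sigma>) * exp (- 2 * real n * \<mu> / \<sigma>)
         * ((- \<sigma> / 2) ^ (l + 1) * inc_Gamma (1 + l) (- 2 * v / \<sigma>)))"
      unfolding s by (simp only: mult_minus_left mult_minus_right)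
    also have "\<dots> = - (exp (z / \<sigma>) *
      (fact l * (- \<sigma> / 2) ^ (l + 1) - v ^ (l + 1) / real (l + 1) + ?S (- \<sigma> / 2) l))"
      unfolding g e[symmetric] by (simp only: mult.assoc)
    finally show ?thesis unfolding s by (simp only: algebra_simps)
  qed
  have B: "exp (- z / \<sigma>) * (v ^ (l + 1) / real (l + 1))
       + exp (z / \<sigma>) * (exp (2 * real n * \<mu> / \<sigma>) * \<sigma> ^ (l + 1) / 2 ^ (l + 1)
         * inc_Gamma (1 + l) (2 * v / \<sigma>))
     = exp (- z / \<sigma>) * (fact l * (\<sigma> ^ (l + 1) / 2 ^ (l + 1)) + ?S (\<sigma> / 2) l)" for l
  proof -
    have s: "\<sigma> ^ (l + 1) / 2 ^ (l + 1) = (\<sigma> / 2) ^ (l + 1)"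
      by (simp only: power_divide)
    have e: "exp (z / \<sigma>) * exp (2 * real n * \<mu> / \<sigma>) * exp (- v / (\<sigma> / 2)) = exp (- z / \<sigma>)"
      unfolding exp_add[symmetric] v_def using sigma_pos by (simp add: field_simps)
    have g: "(\<sigma> / 2) ^ (l + 1) * inc_Gamma (1 + l) (2 * v / \<sigma>) = exp (- v / (\<sigma> / 2)) *
      (fact l * (\<sigma> / 2) ^ (l + 1) - v ^ (l + 1) / real (l + 1) + ?S (\<sigma> / 2) l)"
      using inc_Gamma_scaled_expansion[of "\<sigma> / 2" l v] sigma_pos by (simp add: mult.commute)
    have "exp (z / \<sigma>) * (exp (2 * real n * \<mu> / \<sigma>) * \<sigma> ^ (l + 1) / 2 ^ (l + 1)
         * inc_Gamma (1 + l) (2 * v / \<sigma>))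
      = exp (z / \<sigma>) * exp (2 * real n * \<mu> / \<sigma>) * ((\<sigma> / 2) ^ (l + 1) * inc_Gamma (1 + l) (2 * v / \<sigma>))"
      unfolding s[symmetric] by simp
    also have "\<dots> = exp (- z / \<sigma>) *
      (fact l * (\<sigma> / 2) ^ (l + 1) - v ^ (l + 1) / real (l + 1) + ?S (\<sigma> / 2) l)"
      unfolding g e[symmetric] by (simp only: mult.assoc)
    finally show ?thesis unfolding s by (simp only: distrib_left right_diff_distrib)
  qed
  have E: "exp (- z / \<sigma>) * exp (z / \<sigma>) = 1" by (simp flip: exp_add)
  \<comment> \<open>\<open>F\<close> and \<open>E\<close> are the outer exponentials, \<open>G\<close> and \<open>H\<close> the Gamma terms and \<open>P\<close> the plain powers: the coefficients
    \<open>a\<close> and \<open>b\<close> each meet one of both kinds.\<close>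
  have split: "F * ((\<Sum>l\<in>A. a l * G l + b l * P l) + e * E) - E * ((\<Sum>l\<in>A. a l * P l - b l * H l) - e * F)
    = (\<Sum>l\<in>A. a l * (F * G l - E * P l)) + (\<Sum>l\<in>A. b l * (F * P l + E * H l)) + 2 * e * (F * E)"
    for F E e :: real and A :: "nat set" and a b G H P
    by (simp add: algebra_simps sum_distrib_left sum.distrib sum_subtractf)
  show ?thesis
    unfolding prim_below_def prim_above_def v_def[symmetric] mult.assoc[of "be n k _" _ "inc_Gamma _ _"]
      mult.assoc[of "al n k _" _ "inc_Gamma _ _"] split
    unfolding A B E
    by (simp add: sum_distrib_left algebra_simps)
qed

text \<open>The recursion in terms of the primitives. The terms with \<open>fact k * \<sigma> ^ (k + 1)\<close> in the coefficients of
  index \<open>0\<close> are the constant terms of the expanded Gamma functions at the cut \<open>x + \<mu>\<close>; apart from them, the cell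
  that is cut enters these coefficients only through a primitive at one of its end points.\<close>

lemma alpha_beta_Suc:
  assumes "1 \<le> n"
  shows "al (Suc n) i 0 = exp (\<mu> / \<sigma>) * ((\<Sum>l = star n i + 1..cells n. K_above \<mu> \<sigma> h n l)
      + prim_above n (star n i) (upp n (star n i))
      + (\<Sum>k<terms n (star n i). al n (star n i) k * (fact k * (\<sigma> ^ (k + 1) * (-1) ^ k / 2 ^ (k + 1)))))"
    and "be (Suc n) i 0 = exp (- \<mu> / \<sigma>) * (K0 \<mu> \<sigma> h n + (\<Sum>l = 1..<star n i. K_below \<mu> \<sigma> h n l)
      - prim_below n (star n i) (low n (star n i))
      + (\<Sum>k<terms n (star n i). be n (star n i) k * (fact k * (\<sigma> ^ (k + 1) / 2 ^ (k + 1)))))"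
    and "al (Suc n) i (Suc j) = - exp (\<mu> / \<sigma>) * (\<Sum>k = j..<terms n (star n i).
      al n (star n i) k * ((- \<sigma> / 2) ^ (k - j) * (fact k / fact (Suc j))))"
    and "be (Suc n) i (Suc j) = exp (- \<mu> / \<sigma>) * (\<Sum>k = j..<terms n (star n i).
      be n (star n i) k * ((\<sigma> / 2) ^ (k - j) * (fact k / fact (Suc j))))"
proof -
  have n: "(n = 0) = False" using assms by simp
  show "al (Suc n) i 0 = exp (\<mu> / \<sigma>) * ((\<Sum>l = star n i + 1..cells n. K_above \<mu> \<sigma> h n l)
      + prim_above n (star n i) (upp n (star n i))
      + (\<Sum>k<terms n (star n i). al n (star n i) k * (fact k * (\<sigma> ^ (k + 1) * (-1) ^ k / 2 ^ (k + 1)))))"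
    unfolding alpha.simps n if_False prim_above_def distrib_left[of "al _ _ _"] sum.distrib sum_subtractf
    by simp
  show "be (Suc n) i 0 = exp (- \<mu> / \<sigma>) * (K0 \<mu> \<sigma> h n + (\<Sum>l = 1..<star n i. K_below \<mu> \<sigma> h n l)
      - prim_below n (star n i) (low n (star n i))
      + (\<Sum>k<terms n (star n i). be n (star n i) k * (fact k * (\<sigma> ^ (k + 1) / 2 ^ (k + 1)))))"
    unfolding beta.simps n if_False prim_below_def distrib_left[of "be _ _ _"] sum.distrib sum_subtractf
    by (simp add: sum_negf)
qed (use assms in \<open>simp_all add: alpha.simps beta.simps mult.assoc\<close>)

lemma eta_Suc: "1 \<le> n \<Longrightarrow> i \<le> cells (Suc n) \<Longrightarrow> et (Suc n) i = et n (star n i)"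
  by (simp add: eta.simps)

text \<open>The algebraic core. For \<open>x\<close> in the \<open>i\<close>-th cell, the right-hand side is \<open>2 ^ n * \<sigma> ^ (n - 1)\<close> times the
  integral in \<open>has_integral_fet_kernel\<close>, plus the term with \<open>K0\<close> for the atom at \<open>0\<close>. The coefficients
  with positive index lead to triangular double sums; exchanging the order of summation groups
  them by the coefficient of the previous step.\<close>

lemma piece_Suc:
  fixes x :: real
  assumes n: "1 \<le> n" and i: "i \<in> {1..cells (Suc n)}"
  defines "k \<equiv> star n i" and "z \<equiv> x + \<mu>"
  shows "2 ^ Suc n * \<sigma> ^ n * piece (Suc n) i x =
    exp (- z / \<sigma>) * (K0 \<mu> \<sigma> h n + (\<Sum>l = 1..<k. K_below \<mu> \<sigma> h n l)
      + prim_below n k z - prim_below n k (low n k))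
    + exp (z / \<sigma>) * ((\<Sum>l = k + 1..cells n. K_above \<mu> \<sigma> h n l) + prim_above n k (upp n k) - prim_above n k z)"
    (is "?lhs = ?rhs")
proof -
  define v where "v = z + real n * \<mu>"
  define q where "q = terms n k"
  have v: "x + real (Suc n) * \<mu> = v" by (simp add: v_def z_def algebra_simps)
  let ?S = "\<lambda>s l. \<Sum>j\<le>l. s ^ (l - j) * (fact l / fact (Suc j)) * v ^ Suc j"
  have al: "(\<Sum>j<Suc q. al (Suc n) i j * v ^ j) = al (Suc n) i 0 - exp (\<mu> / \<sigma>) * (\<Sum>l<q. al n k l * ?S (- \<sigma> / 2) l)"
  proof -
    have "(\<Sum>j<q. al (Suc n) i (Suc j) * v ^ Suc j)
      = - exp (\<mu> / \<sigma>) * (\<Sum>j<q. \<Sum>l = j..<q. al n k l * ((- \<sigma> / 2) ^ (l - j) * (fact l / fact (Suc j)) * v ^ Suc j))"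
      unfolding alpha_beta_Suc[OF n] k_def[symmetric] q_def[symmetric] sum_distrib_left sum_distrib_right
      by (simp only: mult.assoc)
    also have "\<dots> = - exp (\<mu> / \<sigma>) * (\<Sum>l<q. al n k l * ?S (- \<sigma> / 2) l)"
      unfolding sum_triangle_swap by (simp only: sum_distrib_left)
    finally show ?thesis unfolding sum.lessThan_Suc_shift by simp
  qed
  have be: "(\<Sum>j<Suc q. be (Suc n) i j * v ^ j) = be (Suc n) i 0 + exp (- \<mu> / \<sigma>) * (\<Sum>l<q. be n k l * ?S (\<sigma> / 2) l)"
  proof -
    have "(\<Sum>j<q. be (Suc n) i (Suc j) * v ^ Suc j)
      = exp (- \<mu> / \<sigma>) * (\<Sum>j<q. \<Sum>l = j..<q. be n k l * ((\<sigma> / 2) ^ (l - j) * (fact l / fact (Suc j)) * v ^ Suc j))"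
      unfolding alpha_beta_Suc[OF n] k_def[symmetric] q_def[symmetric] sum_distrib_left sum_distrib_right
      by (simp only: mult.assoc)
    also have "\<dots> = exp (- \<mu> / \<sigma>) * (\<Sum>l<q. be n k l * ?S (\<sigma> / 2) l)"
      unfolding sum_triangle_swap by (simp only: sum_distrib_left)
    finally show ?thesis unfolding sum.lessThan_Suc_shift by simp
  qed
  have m: "terms (Suc n) i = Suc q" using mm_Suc[OF n i] by (simp add: q_def k_def)
  have eta: "et (Suc n) i = et n k" using i by (simp add: eta_Suc[OF n] k_def)
  have "?lhs = (\<Sum>j<Suc q. al (Suc n) i j * v ^ j) * exp (x / \<sigma>)
    + (\<Sum>j<Suc q. be (Suc n) i j * v ^ j) * exp (- x / \<sigma>) + 2 * (2 * \<sigma>) ^ n * et n k"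
  proof -
    have "2 ^ Suc n * \<sigma> ^ n * (\<Sum>j<Suc q. 1 / (2 ^ Suc n * \<sigma> ^ (Suc n - 1)) * f j) = (\<Sum>j<Suc q. f j)" for f
      unfolding sum_distrib_left using sigma_pos by (intro sum.cong) auto
    then show ?thesis
      unfolding piece_def m v eta distrib_left[of "_ * \<sigma> ^ n"] sum.distrib sum_distrib_right
      by (simp add: power_mult_distrib sum.distrib del: sum.lessThan_Suc)
  qed
  also have "\<dots> = exp (\<mu> / \<sigma>) * exp (x / \<sigma>) * ((\<Sum>l = k + 1..cells n. K_above \<mu> \<sigma> h n l) + prim_above n k (upp n k)
      + (\<Sum>l<q. al n k l * (fact l * (\<sigma> ^ (l + 1) * (-1) ^ l / 2 ^ (l + 1)) - ?S (- \<sigma> / 2) l)))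
    + exp (- \<mu> / \<sigma>) * exp (- x / \<sigma>) * (K0 \<mu> \<sigma> h n + (\<Sum>l = 1..<k. K_below \<mu> \<sigma> h n l) - prim_below n k (low n k)
      + (\<Sum>l<q. be n k l * (fact l * (\<sigma> ^ (l + 1) / 2 ^ (l + 1)) + ?S (\<sigma> / 2) l)))
    + 2 * (2 * \<sigma>) ^ n * et n k"
    unfolding al be alpha_beta_Suc(1,2)[OF n] k_def[symmetric] q_def[symmetric]
      right_diff_distrib[of "al _ _ _"] distrib_left[of "be _ _ _"] sum.distrib sum_subtractf
    by (simp only: algebra_simps)
  also have "exp (\<mu> / \<sigma>) * exp (x / \<sigma>) = exp (z / \<sigma>)"
    by (simp add: z_def add_divide_distrib add.commute flip: exp_add)
  also have "exp (- \<mu> / \<sigma>) * exp (- x / \<sigma>) = exp (- z / \<sigma>)"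
    by (simp add: z_def diff_divide_distrib flip: exp_add)
  finally show ?thesis
    using kernel_primitives[OF n, of x k] unfolding z_def[symmetric] v_def[symmetric] q_def[symmetric]
    by (simp only: algebra_simps)
qed

text \<open>The first-step recursion, solved for the integral.\<close>

lemma fet_Suc:
  assumes n: "1 \<le> n" and x: "0 \<le> x" "x < h"
  shows "((\<lambda>y. fet n y * exp (- \<bar>y - (x + \<mu>)\<bar> / \<sigma>)) has_integral
    2 * \<sigma> * (fet (Suc n) x - exp (- (x + \<mu>) / \<sigma>) / 2 * fet n 0)) {0..h}"
proof -
  obtain i where i: "i \<in> {1..cells (Suc n)}" "x \<in> cell (Suc n) i"
    using Ivl_cover[OF x] by blast
  define k where "k = star n i"
  \<comment> \<open>The normalising constant of time \<open>n\<close>; the one of time \<open>n + 1\<close> is \<open>2 * \<sigma>\<close> times larger.\<close>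
  define c where "c = 2 ^ n * \<sigma> ^ (n - 1)"
  have c: "c > 0" "2 ^ Suc n * \<sigma> ^ n = 2 * \<sigma> * c" "(2 * \<sigma>) ^ n = \<sigma> * c"
    using n sigma_pos by (cases n; simp add: c_def power_mult_distrib)+
  have k: "h \<le> x + \<mu> \<and> k = cells n + 1 \<or> k \<in> {1..cells n} \<and> x + \<mu> \<in> cell n k"
    using istar_cases[OF n i] unfolding k_def by blast
  have "0 \<in> cell n 1" using lo_less_up[of 1 n] ell_ge_2[OF n] by (simp add: Ivl_def lo_def)
  then have "fet n 0 = piece n 1 0" using ell_ge_2[OF n] by (intro fet_eq_piece) auto
  then have K0: "K0 \<mu> \<sigma> h n = \<sigma> * c * fet n 0" by (simp only: K0_eq[OF n] c)
  note P = piece_Suc[OF n i(1), of x, folded k_def fet_eq_piece[OF i], unfolded K0 c]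
  have "2 * \<sigma> * (fet (Suc n) x - exp (- (x + \<mu>) / \<sigma>) / 2 * fet n 0)
    = (2 * \<sigma> * c * fet (Suc n) x - exp (- (x + \<mu>) / \<sigma>) * (\<sigma> * c * fet n 0)) / c"
    using c(1) by (simp add: field_simps)
  then show ?thesis
    using has_integral_fet_kernel[OF n k, folded c_def]
    unfolding P by (simp add: algebra_simps)
qed

text \<open>On the first cell the threshold \<open>h - x\<close> lies above the location \<open>\<mu>\<close> of the increment, on the second one
  it does not; these are the two cases of the Laplace tail.\<close>

lemma fet_1:
  assumes "0 \<le> x" "x < h"
  shows "fet 1 x = laplace_tail \<mu> \<sigma> (h - x)"
proof -
  obtain i where i: "i \<in> {1..cells 1}" "x \<in> cell 1 i"
    using Ivl_cover[OF assms] by blast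
  have L: "cells 1 = 2" using max_cells_ge_2 by (simp add: ell_eq)
  have "i = 1 \<or> i = 2" using i(1) unfolding L by auto
  then consider "i = 1" "x < h - \<mu>" | "i = 2" "h - \<mu> \<le> x"
    using i(2) L by (auto simp: Ivl_def up_def lo_def)
  then show ?thesis
  proof cases
    case 1
    then show ?thesis
      unfolding fet_eq_piece[OF i]
      by (simp add: piece_def mm_def L[simplified] laplace_tail_def alpha.simps beta.simps eta.simps
          add_divide_distrib diff_divide_distrib algebra_simps flip: exp_add)
  next
    case 2
    have tail: "laplace_tail \<mu> \<sigma> (h - x) = 1 - exp ((h - x - \<mu>) / \<sigma>) / 2"
      using 2 by (cases "h - x = \<mu>") (auto simp: laplace_tail_def)
    show ?thesis
      unfolding fet_eq_piece[OF i] tail using 2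
      by (simp add: piece_def mm_def L[simplified] alpha.simps beta.simps eta.simps
          add_divide_distrib diff_divide_distrib algebra_simps flip: exp_add)
  qed
qed

text \<open>The closed interval \<open>[0, h]\<close> is the domain of integration above, so the value at \<open>h\<close> is needed as well.\<close>

lemma fet_beyond:
  assumes "h \<le> x"
  shows "fet n x = 0"
  unfolding fet_def P_part_eq
proof (intro sum.neutral ballI)
  fix i assume "i \<in> {1..cells n}"
  then have "upp n i \<le> h" using up_mono[of i "cells n" n] by (simp add: up_last)
  then show "piece n i x * indicator (cell n i) x = 0" using assms by (simp add: Ivl_def)
qed

lemma fet_Suc_ge:
  assumes "1 \<le> n" "0 \<le> x" "x < h" and nonneg: "\<And>y. 0 \<le> y \<Longrightarrow> 0 \<le> fet n y"
  shows "exp (- (x + \<mu>) / \<sigma>) / 2 * fet n 0 \<le> fet (Suc n) x"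
proof -
  have *: "0 \<le> 2 * \<sigma> * d \<Longrightarrow> 0 \<le> d" for d :: real
    using sigma_pos by (simp add: zero_le_mult_iff)
  have "0 \<le> fet (Suc n) x - exp (- (x + \<mu>) / \<sigma>) / 2 * fet n 0"
    by (rule *, rule has_integral_nonneg[OF fet_Suc[OF assms(1-3)]]) (use nonneg in auto)
  then show ?thesis by linarith
qed

text \<open>The formula does not show the sign of its values. It is inherited through the recursion, and it makes the passage
  from real integrals to nonnegative Lebesgue integrals possible.\<close>

lemma fet_nonneg:
  assumes "1 \<le> n" "0 \<le> x"
  shows "0 \<le> fet n x"
  using assms
proof (induction n arbitrary: x rule: dec_induct)
  case base
  show ?case
    using fet_1[OF base] fet_beyond[of x 1] laplace_tail_nonneg[OF sigma_pos] by (cases "x < h") auto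
next
  case (step n)
  show ?case
  proof (cases "x < h")
    case True
    have "0 \<le> exp (- (x + \<mu>) / \<sigma>) / 2 * fet n 0" using step.IH[of 0] by simp
    also have "\<dots> \<le> fet (Suc n) x" using step True by (intro fet_Suc_ge) auto
    finally show ?thesis .
  qed (simp add: fet_beyond)
qed

section \<open>The process on the product space\<close>

lemma borel_measurable_fet [measurable]: "fet n \<in> borel_measurable borel"
  unfolding fet_def P_part_def Ivl_def by measurable

definition lap :: "real measure" where
  "lap = density lborel (\<lambda>z. ennreal (laplace_density \<mu> \<sigma> z))"

lemma sets_lap [measurable_cong, simp]: "sets lap = sets borel"
  and space_lap [simp]: "space lap = UNIV"
  by (simp_all add: lap_def)

lemma nn_integral_lap:
  "f \<in> borel_measurable borel \<Longrightarrow>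
    (\<integral>\<^sup>+z. f z \<partial>lap) = (\<integral>\<^sup>+z. ennreal (laplace_density \<mu> \<sigma> z) * f z \<partial>lborel)"
  unfolding lap_def by (rule nn_integral_density) auto

lemma nn_integral_exit_step:
  assumes "0 \<le> x" "x < h"
  shows "(\<integral>\<^sup>+z. indicator {h..} (max 0 (x + z)) \<partial>lap) = ennreal (fet 1 x)"
proof -
  have "(\<integral>\<^sup>+z. indicator {h..} (max 0 (x + z)) \<partial>lap)
    = (\<integral>\<^sup>+z. ennreal (laplace_density \<mu> \<sigma> z) * indicator {h - x..} z \<partial>lborel)"
    using assms mu_pos mu_less
    by (subst nn_integral_lap) (auto intro!: nn_integral_cong simp: indicator_def)
  then show ?thesis by (simp add: nn_integral_laplace_tail[OF sigma_pos] fet_1[OF assms, simplified])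
qed

text \<open>One step of the process: the increments \<open>z \<le> - x\<close> all lead to \<open>0\<close>, which gives the atom, and for
  the others the substitution \<open>w = x + z\<close> turns the Laplace density into the kernel of the recursion.\<close>

lemma nn_integral_survival_step:
  assumes n: "1 \<le> n" and x: "0 \<le> x" "x < h"
  shows "(\<integral>\<^sup>+z. indicator {..<h} (max 0 (x + z)) * ennreal (fet n (max 0 (x + z))) \<partial>lap)
    = ennreal (fet (Suc n) x)"
proof -
  let ?f = "laplace_density \<mu> \<sigma>"
  define g where "g w = ennreal (?f (w - x) * fet n w) * indicator {0..h} w" for w
  let ?A = "exp (- (x + \<mu>) / \<sigma>) / 2 * fet n 0"
  have [measurable]: "g \<in> borel_measurable borel" unfolding g_def by measurable
  note nonneg = laplace_density_nonneg[OF sigma_pos] fet_nonneg[OF n]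
  have "(\<integral>\<^sup>+z. indicator {..<h} (max 0 (x + z)) * ennreal (fet n (max 0 (x + z))) \<partial>lap)
    = (\<integral>\<^sup>+z. ennreal (?f z) * (indicator {..<h} (max 0 (x + z)) * ennreal (fet n (max 0 (x + z)))) \<partial>lborel)"
    by (rule nn_integral_lap) measurable
  \<comment> \<open>At \<open>z = - x\<close> both summands count the state \<open>0\<close>; this is a null set.\<close>
  also have "\<dots> = (\<integral>\<^sup>+z. ennreal (?f z) * indicator {..- x} z * ennreal (fet n 0) + g (x + z) \<partial>lborel)"
  proof (intro nn_integral_cong_AE AE_I[where N="{- x}"])
    have "ennreal (?f z) * (indicator {..<h} (max 0 (x + z)) * ennreal (fet n (max 0 (x + z))))
      = ennreal (?f z) * indicator {..- x} z * ennreal (fet n 0) + g (x + z)" if "z \<noteq> - x" for z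
    proof (cases "z < - x")
      case True
      then show ?thesis using mu_pos mu_less by (simp add: g_def indicator_def max_def)
    next
      case False
      then have "0 < x + z" using that by simp
      then show ?thesis
        using fet_beyond[of "x + z" n] nonneg
        by (cases "x + z < h") (auto simp: g_def indicator_def ennreal_mult)
    qed
    then show "{z \<in> space lborel. ennreal (?f z) * (indicator {..<h} (max 0 (x + z)) * ennreal (fet n (max 0 (x + z))))
      \<noteq> ennreal (?f z) * indicator {..- x} z * ennreal (fet n 0) + g (x + z)} \<subseteq> {- x}"
      by auto
  qed auto
  also have "\<dots> = (\<integral>\<^sup>+z. ennreal (?f z) * indicator {..- x} z \<partial>lborel) * ennreal (fet n 0)
      + (\<integral>\<^sup>+z. g (x + z) \<partial>lborel)"
    by (subst nn_integral_add) (auto simp: nn_integral_multc)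
  also have "(\<integral>\<^sup>+z. ennreal (?f z) * indicator {..- x} z \<partial>lborel) * ennreal (fet n 0) = ennreal ?A"
    using x mu_pos nonneg(2)[of 0]
    by (simp add: nn_integral_laplace_left_tail[OF sigma_pos] laplace_tail_def flip: ennreal_mult)
  also have "(\<integral>\<^sup>+z. g (x + z) \<partial>lborel) = (\<integral>\<^sup>+w. g w \<partial>lborel)"
    by (subst nn_integral_real_affine[of g 1 x]) auto
  also have "\<dots> = ennreal (fet (Suc n) x - ?A)"
  proof -
    have "((\<lambda>w. 1 / (2 * \<sigma>) * (fet n w * exp (- \<bar>w - (x + \<mu>)\<bar> / \<sigma>))) has_integral
      1 / (2 * \<sigma>) * (2 * \<sigma> * (fet (Suc n) x - ?A))) {0..h}"
      by (rule has_integral_mult_right[OF fet_Suc[OF n x]])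
    moreover have "1 / (2 * \<sigma>) * (fet n w * exp (- \<bar>w - (x + \<mu>)\<bar> / \<sigma>)) = ?f (w - x) * fet n w" for w
      by (simp add: laplace_density_def diff_diff_eq)
    moreover have "1 / (2 * \<sigma>) * (2 * \<sigma> * (fet (Suc n) x - ?A)) = fet (Suc n) x - ?A"
      using sigma_pos by simp
    ultimately have "((\<lambda>w. ?f (w - x) * fet n w) has_integral fet (Suc n) x - ?A) {0..h}"
      by simp
    then show ?thesis
      unfolding g_def using nonneg by (intro nn_integral_has_integral_lebesgue') auto
  qed
  also have "ennreal ?A + ennreal (fet (Suc n) x - ?A) = ennreal (fet (Suc n) x)"
  proof -
    have "0 \<le> fet (Suc n) x - ?A"
      using fet_Suc_ge[OF n x nonneg(2)] by simp
    then show ?thesis using nonneg(2)[of 0] by (subst ennreal_plus[symmetric]) auto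
  qed
  finally show ?thesis .
qed

text \<open>The joint law of the first \<open>n\<close> increments. Paths are functions on the index set of the increments, and
  the process becomes a function of the path.\<close>

abbreviation path_measure :: "nat \<Rightarrow> (nat \<Rightarrow> real) measure" where
  "path_measure n \<equiv> Pi\<^sub>M {1..n} (\<lambda>_. lap)"

definition walk :: "real \<Rightarrow> nat \<Rightarrow> (nat \<Rightarrow> real) \<Rightarrow> real" where
  "walk x = lindley x (\<lambda>i \<omega>. \<omega> i)"

definition survives :: "real \<Rightarrow> nat \<Rightarrow> (nat \<Rightarrow> real) \<Rightarrow> bool" where
  "survives x n \<omega> \<longleftrightarrow> (\<forall>k\<in>{1..n}. walk x k \<omega> < h)"

lemma walk_simps: "walk x 0 \<omega> = x" "walk x (Suc n) \<omega> = max 0 (walk x n \<omega> + \<omega> (Suc n))"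
  by (simp_all add: walk_def)

lemma walk_nonneg: "0 \<le> x \<Longrightarrow> 0 \<le> walk x k \<omega>"
  unfolding walk_def by (rule lindley_nonneg)

lemma walk_upd: "k \<le> n \<Longrightarrow> walk x k (fun_upd \<omega> (Suc n) z) = walk x k \<omega>"
  unfolding walk_def by (rule lindley_cong) simp

lemma survives_less: "x < h \<Longrightarrow> survives x n \<omega> \<Longrightarrow> walk x n \<omega> < h"
  by (cases n) (auto simp: survives_def walk_simps(1))

lemma survives_upd: "survives x n (fun_upd \<omega> (Suc n) z) = survives x n \<omega>"
  by (simp add: survives_def walk_upd)

lemma measurable_walk [measurable]: "k \<le> n \<Longrightarrow> walk x k \<in> borel_measurable (path_measure n)"
proof (induction k)
  case (Suc k)
  then have [measurable]: "walk x k \<in> borel_measurable (path_measure n)" by simp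
  have [measurable]: "(\<lambda>\<omega>. \<omega> (Suc k)) \<in> borel_measurable (path_measure n)"
    using measurable_component_singleton[of "Suc k" "{1..n}" "\<lambda>_. lap"] Suc.prems
    by (simp cong: measurable_cong_sets)
  show ?case unfolding walk_simps(2)[abs_def] by measurable
qed (simp add: walk_simps(1)[abs_def])

lemma measurable_survives [measurable]: "k \<le> n \<Longrightarrow> Measurable.pred (path_measure n) (survives x k)"
  unfolding survives_def[abs_def]
proof (intro pred_intros_finite)
  fix i assume "k \<le> n" "i \<in> {1..k}"
  then have [measurable]: "walk x i \<in> borel_measurable (path_measure n)" by (intro measurable_walk) auto
  show "Measurable.pred (path_measure n) (\<lambda>\<omega>. walk x i \<omega> < h)" by measurable
qed simp

text \<open>By Fubini the last increment is integrated first. It does not influence the process before step \<open>n + 1\<close>.\<close>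

lemma nn_integral_path_Suc:
  assumes [measurable]: "g \<in> borel_measurable borel"
  shows "(\<integral>\<^sup>+\<omega>. of_bool (survives x n \<omega>) * g (walk x (Suc n) \<omega>) \<partial>path_measure (Suc n))
    = (\<integral>\<^sup>+\<omega>. of_bool (survives x n \<omega>) * (\<integral>\<^sup>+z. g (max 0 (walk x n \<omega> + z)) \<partial>lap) \<partial>path_measure n)"
proof -
  have "sigma_finite_measure lap"
    unfolding lap_def by (subst sigma_finite_measure.sigma_finite_iff_density_finite[OF lborel.sigma_finite_measure_axioms]) auto
  then interpret product_sigma_finite "\<lambda>_::nat. lap"
    by (simp add: product_sigma_finite_def)
  have ins: "{1..Suc n} = insert (Suc n) {1..n}" by auto
  have "(\<lambda>\<omega>. of_bool (survives x n \<omega>) * g (walk x (Suc n) \<omega>)) \<in> borel_measurable (path_measure (Suc n))"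
    by measurable
  then show ?thesis
    unfolding ins
    by (subst product_nn_integral_insert)
      (auto simp: survives_upd walk_upd walk_simps nn_integral_cmult intro!: nn_integral_cong)
qed

text \<open>Removing one increment from the path raises the index of \<open>fet\<close>. So the induction on the length of the path needs
  the claim for all indices of \<open>fet\<close>.\<close>

lemma nn_integral_fet_survives:
  assumes x: "0 \<le> x" "x < h"
  shows "(\<integral>\<^sup>+\<omega>. of_bool (survives x n \<omega>) * ennreal (fet (Suc m) (walk x n \<omega>)) \<partial>path_measure n)
    = ennreal (fet (Suc m + n) x)"
proof (induction n arbitrary: m)
  case 0
  show ?case by (simp add: survives_def walk_simps PiM_empty nn_integral_count_space_finite)
next
  case (Suc n)
  \<comment> \<open>Surviving the last step is a condition on the last state only, so it is moved into the integrand.\<close>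
  let ?g = "\<lambda>y. indicator {..<h} y * ennreal (fet (Suc m) y)"
  have "(\<integral>\<^sup>+\<omega>. of_bool (survives x (Suc n) \<omega>) * ennreal (fet (Suc m) (walk x (Suc n) \<omega>)) \<partial>path_measure (Suc n))
    = (\<integral>\<^sup>+\<omega>. of_bool (survives x n \<omega>) * ?g (walk x (Suc n) \<omega>) \<partial>path_measure (Suc n))"
    by (intro nn_integral_cong) (auto simp: survives_def indicator_def atLeastAtMostSuc_conv)
  also have "\<dots> = (\<integral>\<^sup>+\<omega>. of_bool (survives x n \<omega>) * (\<integral>\<^sup>+z. ?g (max 0 (walk x n \<omega> + z)) \<partial>lap) \<partial>path_measure n)"
    by (rule nn_integral_path_Suc) measurable
  also have "\<dots> = (\<integral>\<^sup>+\<omega>. of_bool (survives x n \<omega>) * ennreal (fet (Suc (Suc m)) (walk x n \<omega>)) \<partial>path_measure n)"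
  proof (intro nn_integral_cong)
    fix \<omega>
    show "of_bool (survives x n \<omega>) * (\<integral>\<^sup>+z. ?g (max 0 (walk x n \<omega> + z)) \<partial>lap)
      = of_bool (survives x n \<omega>) * ennreal (fet (Suc (Suc m)) (walk x n \<omega>))"
    proof (cases "survives x n \<omega>")
      case True
      from nn_integral_survival_step[OF _ walk_nonneg[OF x(1)] survives_less[OF x(2) True], of "Suc m"]
      show ?thesis by simp
    qed simp
  qed
  also have "\<dots> = ennreal (fet (Suc m + Suc n) x)"
    using Suc[of "Suc m"] by simp
  finally show ?case .
qed

lemma emeasure_path_exit:
  assumes x: "0 \<le> x" "x < h"
  shows "emeasure (path_measure (Suc n))
      {\<omega> \<in> space (path_measure (Suc n)). survives x n \<omega> \<and> h \<le> walk x (Suc n) \<omega>}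
    = ennreal (fet (Suc n) x)"
proof -
  let ?A = "{\<omega> \<in> space (path_measure (Suc n)). survives x n \<omega> \<and> h \<le> walk x (Suc n) \<omega>}"
  have "emeasure (path_measure (Suc n)) ?A = (\<integral>\<^sup>+\<omega>. indicator ?A \<omega> \<partial>path_measure (Suc n))"
    by (rule nn_integral_indicator[symmetric]) measurable
  also have "\<dots> = (\<integral>\<^sup>+\<omega>. of_bool (survives x n \<omega>) * indicator {h..} (walk x (Suc n) \<omega>) \<partial>path_measure (Suc n))"
    by (intro nn_integral_cong) (auto simp: indicator_def)
  also have "\<dots> = (\<integral>\<^sup>+\<omega>. of_bool (survives x n \<omega>)
      * (\<integral>\<^sup>+z. indicator {h..} (max 0 (walk x n \<omega> + z)) \<partial>lap) \<partial>path_measure n)"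
    by (rule nn_integral_path_Suc) measurable
  also have "\<dots> = (\<integral>\<^sup>+\<omega>. of_bool (survives x n \<omega>) * ennreal (fet (Suc 0) (walk x n \<omega>)) \<partial>path_measure n)"
  proof (intro nn_integral_cong)
    fix \<omega>
    show "of_bool (survives x n \<omega>) * (\<integral>\<^sup>+z. indicator {h..} (max 0 (walk x n \<omega> + z)) \<partial>lap)
      = of_bool (survives x n \<omega>) * ennreal (fet (Suc 0) (walk x n \<omega>))"
    proof (cases "survives x n \<omega>")
      case True
      from nn_integral_exit_step[OF walk_nonneg[OF x(1)] survives_less[OF x(2) True]]
      show ?thesis by simp
    qed simp
  qed
  also have "\<dots> = ennreal (fet (Suc n) x)"
    using nn_integral_fet_survives[OF x, of n 0] by simp
  finally show ?thesis .
qed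

lemma distr_increments:
  assumes "prob_space M" and indep: "prob_space.indep_vars M (\<lambda>_. borel) Z {1..}"
    and dist: "\<And>k. 1 \<le> k \<Longrightarrow> distributed M lborel (Z k) (\<lambda>z. ennreal (laplace_density \<mu> \<sigma> z))"
  shows "distr M (Pi\<^sub>M {1..Suc n} (\<lambda>_. borel)) (\<lambda>\<omega>. \<lambda>i\<in>{1..Suc n}. Z i \<omega>) = path_measure (Suc n)"
proof -
  interpret prob_space M by fact
  have rv: "Z k \<in> borel_measurable M" if "1 \<le> k" for k
    using distributed_measurable[OF dist[OF that]] by simp
  have "indep_vars (\<lambda>_. borel) Z {1..Suc n}"
    by (rule indep_vars_subset[OF indep]) auto
  then have "distr M (Pi\<^sub>M {1..Suc n} (\<lambda>_. borel)) (\<lambda>\<omega>. \<lambda>i\<in>{1..Suc n}. Z i \<omega>)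
    = Pi\<^sub>M {1..Suc n} (\<lambda>i. distr M borel (Z i))"
    by (subst indep_vars_iff_distr_eq_PiM'[symmetric]) (auto intro: rv)
  also have "\<dots> = path_measure (Suc n)"
  proof (rule PiM_cong[OF refl])
    fix k assume "k \<in> {1..Suc n}"
    then have "distr M lborel (Z k) = lap"
      unfolding lap_def by (intro distributed_distr_eq_density dist) simp
    moreover have "distr M borel (Z k) = distr M lborel (Z k)"
      by (rule distr_cong) auto
    ultimately show "distr M borel (Z k) = lap" by simp
  qed
  finally show ?thesis .
qed

end

theorem theorem4p1:
  fixes M :: "'a measure" and Z :: "nat \<Rightarrow> 'a \<Rightarrow> real"
    and \<mu> \<sigma> h x :: real and n :: nat
  assumes "prob_space M"
    and "prob_space.indep_vars M (\<lambda>_. borel) Z {1..}"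
    and "\<And>k. 1 \<le> k \<Longrightarrow> distributed M lborel (Z k) (\<lambda>z. ennreal (laplace_density \<mu> \<sigma> z))"
    and "0 < \<sigma>" and "0 < \<mu>" and "\<mu> < h"
    and "0 < n" and "0 \<le> x" and "x < h"
  shows "measure M {\<omega> \<in> space M. exit_time h x Z \<omega> = enat n}
       = (\<Sum>i = 1..ell \<mu> h n. P_part \<mu> \<sigma> h i n x)"
proof -
  interpret prob_space M by fact
  interpret lindley_laplace \<mu> \<sigma> h by unfold_locales fact+
  obtain n' where n: "n = Suc n'" using \<open>0 < n\<close> by (cases n) auto
  let ?N = "Pi\<^sub>M {1..n} (\<lambda>_. borel :: real measure)"
  let ?Y = "\<lambda>\<omega>. \<lambda>i\<in>{1..n}. Z i \<omega>"
  let ?A = "{\<omega> \<in> space (path_measure n). survives x n' \<omega> \<and> h \<le> walk x n \<omega>}"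
  have distr: "distr M ?N ?Y = path_measure n"
    unfolding n by (rule distr_increments) fact+
  have rv: "Z k \<in> borel_measurable M" if "1 \<le> k" for k
    using distributed_measurable[OF assms(3)[OF that]] by simp
  have Y: "?Y \<in> measurable M ?N"
    by (rule measurable_restrict) (auto intro: rv)
  have walk: "walk x k (?Y \<omega>) = lindley x Z k \<omega>" if "k \<le> n" for k \<omega>
    unfolding walk_def by (rule lindley_cong) (use that in auto)
  have "?A \<in> sets (path_measure n)" unfolding n by measurable
  moreover have "sets (path_measure n) = sets ?N" by (rule sets_PiM_cong) simp_all
  ultimately have A: "?A \<in> sets ?N" by simp
  have "{\<omega> \<in> space M. exit_time h x Z \<omega> = enat n} = ?Y -` ?A \<inter> space M"
  proof -
    have "?Y \<omega> \<in> space (path_measure n)" for \<omega> by (simp add: space_PiM)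
    moreover have "survives x n' (?Y \<omega>) \<longleftrightarrow> (\<forall>k\<in>{1..<n}. lindley x Z k \<omega> < h)" for \<omega>
    proof -
      have "walk x k (?Y \<omega>) = lindley x Z k \<omega>" if "k \<in> {1..n'}" for k
        by (rule walk) (use that n in simp)
      moreover have "{1..<n} = {1..n'}" using n by auto
      ultimately show ?thesis unfolding survives_def by (metis (no_types, lifting))
    qed
    ultimately show ?thesis
      unfolding exit_time_eq_iff using \<open>0 < n\<close> walk[OF order_refl]
      by (intro set_eqI) (simp only: mem_Collect_eq vimage_eq Int_iff simp_thms conj_ac)
  qed
  then have "emeasure M {\<omega> \<in> space M. exit_time h x Z \<omega> = enat n} = emeasure (path_measure n) ?A"
    unfolding distr[symmetric] using Y A[unfolded distr[symmetric]] by (simp add: emeasure_distr)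
  also have "\<dots> = ennreal (fet n x)"
    unfolding n by (rule emeasure_path_exit) fact+
  finally show ?thesis
    using fet_nonneg[of n x] \<open>0 < n\<close> \<open>0 \<le> x\<close> by (simp add: measure_def fet_def)
qed

end
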